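(* Let $(\mathfrak{h}_1,\langle\;,\;\rangle_1)$ be a Euclidean vector space, $(\mathfrak{h}_2,\circ_2,\langle\;,\;\rangle_2)$ a Euclidean algebra, $B_i$ a skew-symmetric endomorphism of $\mathfrak{h}_i$, $i=1,2$, and $\rho_1:\mathfrak{h}_1\to\mathrm{End}(\mathfrak{h}_2)$, $\rho_2:\mathfrak{h}_2\to\mathrm{End}(\mathfrak{h}_1)$ linear maps such that: (i) $\mathrm{tr}(\rho_1(X))=0$ and $[\rho_1(X),\rho_1(Y)]=0$ for all $X,Y\in\mathfrak{h}_1$; (ii) $\rho_2(X\circ_2Y-Y\circ_2X)=[\rho_2(X),\rho_2(Y)]$ for all $X,Y\in\mathfrak{h}_2$; (iii) with the bilinear maps $\omega_1:\mathfrak{h}_1\times\mathfrak{h}_1\to\mathfrak{h}_2$ and $\omega_2:\mathfrak{h}_2\times\mathfrak{h}_2\to\mathfrak{h}_1$ defined by $$\langle\omega_1(X,Y),Z\rangle_2=\langle\rho_2(Z)(X),Y\rangle_1+\langle\rho_2(Z)(Y),X\rangle_1,\quad X,Y\in\mathfrak{h}_1,\ Z\in\mathfrak{h}_2,$$ $$\langle\omega_2(X,Y),Z\rangle_1=\langle\rho_1(Z)(X),Y\rangle_2+\langle\rho_1(Z)(Y),X\rangle_2,\quad X,Y\in\mathfrak{h}_2,\ Z\in\mathfrak{h}_1,$$ the following two systems hold. System (S2), for all $X,Y,Z\in\mathfrak{h}_2$: - $\langle X\circ_2Y-Y\circ_2X,Z\rangle_2=\langle Y\circ_2Z,X\rangle_2-\langle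 X\circ_2Z,Y\rangle_2$; - $\mathrm{ass}_{\circ_2}(X,Y,Z)-\mathrm{ass}_{\circ_2}(Y,X,Z)=\langle Y,Z\rangle_2X-\langle X,Z\rangle_2Y$; - $B_2(X\circ_2Y)=B_2(X)\circ_2Y+X\circ_2B_2(Y)$; - $\langle B_2X,Y\rangle_2=-\langle B_2Y,X\rangle_2$ and $\mathrm{tr}(\mathrm{L}^{\circ_2}_X)=-\mathrm{tr}(\rho_2(X))$. System (S3): - $\rho_1(X)(Y\circ_2Z)=Y\circ_2\rho_1(X)(Z)+\rho_1(X)(Y)\circ_2Z-\rho_1(\rho_2(Y)(X))(Z)-\omega_1(X,\omega_2(Y,Z))$ for $X\in\mathfrak{h}_1$, $Y,Z\in\mathfrak{h}_2$; - $\rho_2(\rho_1(Y)(X))(Z)+\omega_2(X,\omega_1(Y,Z))=0$ for $X\in\mathfrak{h}_2$, $Y,Z\in\mathfrak{h}_1$; - $\rho_1(X)(\omega_1(Y,Z))-\rho_1(Y)(\omega_1(X,Z))=0$ for $X,Y,Z\in\mathfrak{h}_1$; - $\rho_2(X)(\omega_2(Y,Z))-\rho_2(Y)(\omega_2(X,Z))+\omega_2(X,Y\circ_2Z)-\omega_2(Y,X\circ_2Z)-\omega_2([X,Y],Z)=0$ for $X,Y,Z\in\mathfrak{h}_2$, where $[X,Y]=X\circ_2Y-Y\circ_2X$; - $\omega_2(\rho_1(X)(Y),Z)+\omega_2(Y,\rho_1(X)(Z))=0$ for $X\in\mathfrak{h}_1$, $Y,Z\in\mathfrak{h}_2$; -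 $X\circ_2(\omega_1(Y,Z))=\omega_1(\rho_2(X)(Y),Z)+\omega_1(Y,\rho_2(X)(Z))-\langle Y,Z\rangle_1X$ for $X\in\mathfrak{h}_2$, $Y,Z\in\mathfrak{h}_1$; - $[B_2,\rho_1(X)]=\rho_1(B_1(X))+\frac12\rho_1(X)$ for $X\in\mathfrak{h}_1$; - $[B_1,\rho_2(X)]=\rho_2(B_2(X))$ for $X\in\mathfrak{h}_2$. Then $\mathfrak{g}=\mathfrak{h}_1\oplus\mathfrak{h}_2\oplus\mathbb{R}H$ endowed with the product $\bullet$ given by $$X\bullet Y=\begin{cases}\omega_1(X,Y)+\langle X,Y\rangle_1H,& X,Y\in\mathfrak{h}_1,\\ \omega_2(X,Y)+X\circ_2Y+\langle X,Y\rangle_2H,& X,Y\in\mathfrak{h}_2,\\ \rho_1(X)(Y),& X\in\mathfrak{h}_1,\ Y\in\mathfrak{h}_2,\\ \rho_2(X)(Y),& X\in\mathfrak{h}_2,\ Y\in\mathfrak{h}_1,\end{cases}$$ $$H\bullet X=B_1(X)+\tfrac12X,\ X\bullet H=0\ (X\in\mathfrak{h}_1);\quad H\bullet X=B_2(X)+X,\ X\bullet H=X\ (X\in\mathfrak{h}_2);\quad H\bullet H=H,$$ is an LSPK, and its Koszul form $\mathrm{B}$ is given by $\mathrm{B}(\mathfrak{h}_1,\mathfrak{h}_2)=\mathrm{B}(H,\mathfrak{h}_1)=\mathrm{B}(H,\mathfrak{h}_2)=0$, $$\mathrm{B}(X,Y)=\rho\langle X,Y\rangle_i,\ X,Y\in\mathfrak{h}_i,\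 i=1,2,\qquad \mathrm{B}(H,H)=\rho,$$ where $\rho=\frac12\dim\mathfrak{h}_1+\dim\mathfrak{h}_2+1$. Moreover, all LSPK are obtained in this way, i.e. every LSPK is isomorphic to one constructed from such data.
   Context: All algebras are real and finite-dimensional; LSPK are nonzero, while $\mathfrak{h}_1$, $\mathfrak{h}_2$ may be zero. A Euclidean algebra is a (not necessarily associative) algebra endowed with a scalar product (positive definite). For a product $\circ_2$, $\mathrm{ass}_{\circ_2}(X,Y,Z)=(X\circ_2Y)\circ_2Z-X\circ_2(Y\circ_2Z)$ and $\mathrm{L}^{\circ_2}_XY=X\circ_2Y$. An algebra $(\mathfrak{g},\bullet)$ is left symmetric if its associator $\mathrm{ass}(X,Y,Z)=(X\bullet Y)\bullet Z-X\bullet(Y\bullet Z)$ satisfies $\mathrm{ass}(X,Y,Z)=\mathrm{ass}(Y,X,Z)$. Its Koszul form is $\mathrm{B}(X,Y)=\mathrm{tr}(\mathrm{L}_{X\bullet Y})$, where $\mathrm{L}_XY=X\bullet Y$. An LSPK is a real left symmetric algebra whose Koszul form is positive definite. *)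

theory Defs
  imports "HOL-Analysis.Analysis"
begin

section \<open>Linear algebra on subspaces\<close>

text \<open>
  The vector spaces of the theory are finite-dimensional linear subspaces (carriers) of
  arbitrary real vector space types.  A type of class \<open>euclidean_space\<close> is never zero-dimensional
  and would fix the scalar product, whereas here zero spaces and arbitrary scalar products are
  needed.  All maps are constrained on carriers only.
\<close>

definition fin_dim_subspace :: "'a::real_vector set \<Rightarrow> bool" where
  "fin_dim_subspace V \<longleftrightarrow> (\<exists>b. finite b \<and> span b = V)"

definition linear_on :: "'a::real_vector set \<Rightarrow> 'b::real_vector set \<Rightarrow> ('a \<Rightarrow> 'b) \<Rightarrow> bool" where
  "linear_on V W f \<longleftrightarrow>
     (\<forall>x\<in>V. f x \<in> W) \<and>
     (\<forall>x\<in>V. \<forall>y\<in>V. f (x + y) = f x + f y) \<and>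
     (\<forall>c. \<forall>x\<in>V. f (c *\<^sub>R x) = c *\<^sub>R f x)"

definition bilinear_on ::
  "'a::real_vector set \<Rightarrow> 'b::real_vector set \<Rightarrow> 'c::real_vector set \<Rightarrow> ('a \<Rightarrow> 'b \<Rightarrow> 'c) \<Rightarrow> bool" where
  "bilinear_on U V W f \<longleftrightarrow>
     (\<forall>x\<in>U. linear_on V W (f x)) \<and> (\<forall>y\<in>V. linear_on U W (\<lambda>x. f x y))"

definition scalar_product_on :: "'a::real_vector set \<Rightarrow> ('a \<Rightarrow> 'a \<Rightarrow> real) \<Rightarrow> bool" where
  "scalar_product_on V ip \<longleftrightarrow>
     bilinear_on V V UNIV ip \<and>
     (\<forall>x\<in>V. \<forall>y\<in>V. ip x y = ip y x) \<and>
     (\<forall>x\<in>V. x \<noteq> 0 \<longrightarrow> 0 < ip x x)"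

definition trace_on :: "'a::real_vector set \<Rightarrow> ('a \<Rightarrow> 'a) \<Rightarrow> real" where
  "trace_on V f =
     (let b = (SOME b. finite b \<and> independent b \<and> span b = V)
      in \<Sum>v\<in>b. representation b (f v) v)"

text \<open>The \<open>SOME\<close> in \<open>trace_on\<close> is harmless: every basis gives the same value.\<close>

lemma trace_on_eq:
  fixes V :: "'a::real_vector set"
  assumes f: "linear_on V V f" and b: "finite b" "independent b" "span b = V"
  shows "trace_on V f = (\<Sum>v\<in>b. representation b (f v) v)"
proof -
  define c where "c = (SOME b. finite b \<and> independent b \<and> span b = V)"
  have c: "finite c \<and> independent c \<and> span c = V"
    unfolding c_def by (rule someI_ex) (use b in blast)
  have fV: "f x \<in> V" if "x \<in> V" for x
    using f that by (simp add: linear_on_def)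
  have f0: "f 0 = 0"
    using f b(3) span_zero[of b] unfolding linear_on_def by (metis scale_zero_left)
  have fsum: "f (\<Sum>v\<in>A. g v *\<^sub>R v) = (\<Sum>v\<in>A. g v *\<^sub>R f v)" if "finite A" "A \<subseteq> V" for A g
    using that
  proof (induction A rule: finite_induct)
    case empty
    show ?case by (simp add: f0)
  next
    case (insert x A)
    have "(\<Sum>v\<in>A. g v *\<^sub>R v) \<in> V"
      using insert.prems b(3) by (auto intro!: span_sum span_scale)
    moreover have "x \<in> V" "g x *\<^sub>R x \<in> V"
      using insert.prems b(3) by (auto intro: span_scale)
    ultimately show ?case
      using insert f unfolding linear_on_def by auto
  qed
  have bV: "b \<subseteq> V" and cV: "c \<subseteq> V"
    using b(3) c span_superset by blast+
  have "(\<Sum>v\<in>b. representation b (f v) v)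
      = (\<Sum>v\<in>b. \<Sum>w\<in>c. representation c (f v) w * representation b w v)"
  proof (rule sum.cong[OF refl])
    fix v assume "v \<in> b"
    then have "f v \<in> V" using bV fV by blast
    then have "f v = (\<Sum>w\<in>c. representation c (f v) w *\<^sub>R w)"
      using c by (intro sum_representation_eq[symmetric]) auto
    then have "representation b (f v) v
        = representation b (\<Sum>w\<in>c. representation c (f v) w *\<^sub>R w) v" by simp
    also have "\<dots> = (\<Sum>w\<in>c. representation b (representation c (f v) w *\<^sub>R w) v)"
      using b cV by (subst representation_sum) (auto intro!: span_scale)
    also have "\<dots> = (\<Sum>w\<in>c. representation c (f v) w * representation b w v)"
      using b cV by (intro sum.cong) (auto simp: representation_scale)
    finally show "representation b (f v) v
      = (\<Sum>w\<in>c. representation c (f v) w * representation b w v)" .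
  qed
  also have "\<dots> = (\<Sum>w\<in>c. \<Sum>v\<in>b. representation c (representation b w v *\<^sub>R f v) w)"
    using c fV bV
    by (subst sum.swap, intro sum.cong refl) (auto simp: representation_scale subset_iff)
  also have "\<dots> = (\<Sum>w\<in>c. representation c (f w) w)"
  proof (rule sum.cong[OF refl])
    fix w assume "w \<in> c"
    then have w: "w = (\<Sum>v\<in>b. representation b w v *\<^sub>R v)"
      using b cV by (intro sum_representation_eq[symmetric]) auto
    have "f w = (\<Sum>v\<in>b. representation b w v *\<^sub>R f v)"
      using fsum[OF b(1) bV, of "representation b w"] w by simp
    then have "representation c (f w) w
        = representation c (\<Sum>v\<in>b. representation b w v *\<^sub>R f v) w" by simp
    also have "\<dots> = (\<Sum>v\<in>b. representation c (representation b w v *\<^sub>R f v) w)"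
      using c bV fV by (subst representation_sum) (auto intro!: span_scale)
    finally show "(\<Sum>v\<in>b. representation c (representation b w v *\<^sub>R f v) w)
      = representation c (f w) w" by simp
  qed
  finally show ?thesis
    by (simp add: trace_on_def c_def Let_def)
qed

text \<open>The vector of \<open>V\<close> representing a linear form with respect to a scalar product.\<close>

definition riesz_on :: "'a::real_vector set \<Rightarrow> ('a \<Rightarrow> 'a \<Rightarrow> real) \<Rightarrow> ('a \<Rightarrow> real) \<Rightarrow> 'a" where
  "riesz_on V ip f = (THE w. w \<in> V \<and> (\<forall>z\<in>V. ip w z = f z))"

lemma riesz_ex_on:
  fixes b :: "'a::real_vector set" and f :: "'a \<Rightarrow> real"
  assumes "finite b" "scalar_product_on (span b) ip" "linear_on (span b) UNIV f"
  shows "\<exists>w\<in>span b. \<forall>z\<in>span b. ip w z = f z"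
  using assms
proof (induction b arbitrary: f rule: finite_induct)
  case empty
  have "ip 0 (0 *\<^sub>R 0) = 0 *\<^sub>R ip 0 0" "f (0 *\<^sub>R 0) = 0 *\<^sub>R f 0"
    using empty.prems unfolding scalar_product_on_def bilinear_on_def linear_on_def
    by (metis span_zero)+
  then show ?case by simp
next
  case (insert a b)
  let ?V = "span (insert a b)"
  have sub: "x \<in> ?V" if "x \<in> span b" for x
    using that span_mono[of b "insert a b"] by blast
  have aV: "a \<in> ?V" by (simp add: span_base)
  note sp = insert.prems(1)[unfolded scalar_product_on_def bilinear_on_def linear_on_def]
  have addl: "ip (x + y) z = ip x z + ip y z" and scl: "ip (r *\<^sub>R x) z = r * ip x z"
    and addr: "ip z (x + y) = ip z x + ip z y" and scr: "ip z (r *\<^sub>R x) = r * ip z x"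
    and comm: "ip x y = ip y x"
    if "x \<in> ?V" "y \<in> ?V" "z \<in> ?V" for x y z r
    using sp that by auto
  have fadd: "f (x + y) = f x + f y" and fsc: "f (r *\<^sub>R x) = r * f x"
    if "x \<in> ?V" "y \<in> ?V" for x y r
    using insert.prems(2) that unfolding linear_on_def by auto
  have spb: "scalar_product_on (span b) ip"
    using sp sub unfolding scalar_product_on_def bilinear_on_def linear_on_def by auto
  have linb: "linear_on (span b) UNIV g" if "linear_on ?V UNIV g" for g :: "'a \<Rightarrow> real"
    using that sub unfolding linear_on_def by auto
  obtain w where w: "w \<in> span b" "\<forall>z\<in>span b. ip w z = f z"
    using insert.IH[OF spb linb[OF insert.prems(2)]] by blast
  show ?case
  proof (cases "a \<in> span b")
    case True
    then have "?V = span b" by (rule span_redundant)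
    then show ?thesis using w by auto
  next
    case False
    have "linear_on ?V UNIV (ip a)"
      using insert.prems(1) aV by (simp add: scalar_product_on_def bilinear_on_def)
    then obtain p where p: "p \<in> span b" "\<forall>z\<in>span b. ip p z = ip a z"
      using insert.IH[OF spb linb] by blast
    define e where "e = a + (-1) *\<^sub>R p"
    have eV: "e \<in> ?V"
      unfolding e_def using aV sub[OF p(1)] by (intro span_add span_scale)
    have "e \<noteq> 0" using False p(1) unfolding e_def by auto
    then have epos: "0 < ip e e" using sp eV by auto
    have eorth: "ip e z = 0" if "z \<in> span b" for z
    proof -
      have "ip e z = ip a z + (-1) * ip p z"
        unfolding e_def using addl[of a "(-1) *\<^sub>R p" z] scl[of p p z "-1"]
          aV sub[OF p(1)] sub[OF that] span_scale[of p "insert a b" "-1"] by simp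
      then show ?thesis using p(2) that by simp
    qed
    define t where "t = (f e - ip w e) / ip e e"
    let ?w = "w + t *\<^sub>R e"
    have wV: "w \<in> ?V" "t *\<^sub>R e \<in> ?V" "?w \<in> ?V"
      using sub[OF w(1)] eV by (auto intro: span_add span_scale)
    have "ip ?w z = f z" if z: "z \<in> ?V" for z
    proof -
      obtain k where k: "z - k *\<^sub>R a \<in> span b"
        using z by (auto simp: span_insert)
      define y where "y = (z - k *\<^sub>R a) + k *\<^sub>R p"
      have y: "y \<in> span b" unfolding y_def using k p(1) by (intro span_add span_scale)
      have zy: "z = y + k *\<^sub>R e" unfolding y_def e_def by (simp add: algebra_simps)
      have yV: "y \<in> ?V" and keV: "k *\<^sub>R e \<in> ?V"
        using sub[OF y] eV by (auto intro: span_scale)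
      have 1: "ip ?w y = f y"
        using addl[OF wV(1) wV(2) yV] scl[OF eV eV yV, of t] eorth[OF y] w(2) y by simp
      have 2: "ip ?w e = f e"
        using addl[OF wV(1) wV(2) eV] scl[OF eV eV eV, of t] epos by (simp add: t_def)
      have "ip ?w z = ip ?w y + k * ip ?w e"
        unfolding zy using addr[OF yV keV wV(3)] scr[OF eV eV wV(3), of k] by simp
      also have "\<dots> = f z"
        unfolding zy 1 2 using fadd[OF yV keV] fsc[OF eV eV, of k] by simp
      finally show ?thesis .
    qed
    then show ?thesis using wV(3) by blast
  qed
qed

lemma riesz_on:
  fixes V :: "'a::real_vector set"
  assumes V: "fin_dim_subspace V" and ip: "scalar_product_on V ip" and f: "linear_on V UNIV f"
  shows "riesz_on V ip f \<in> V \<and> (\<forall>z\<in>V. ip (riesz_on V ip f) z = f z)"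
  unfolding riesz_on_def
proof (rule theI')
  obtain b where b: "finite b" "V = span b"
    using V unfolding fin_dim_subspace_def by auto
  obtain w where w: "w \<in> V" "\<forall>z\<in>V. ip w z = f z"
    using riesz_ex_on[OF b(1), of ip f] ip f b(2) by auto
  note sp = ip[unfolded scalar_product_on_def bilinear_on_def linear_on_def]
  have addl: "ip (x + y) z = ip x z + ip y z" and scl: "ip (r *\<^sub>R x) z = r * ip x z"
    if "x \<in> V" "y \<in> V" "z \<in> V" for x y z r
    using sp that by auto
  show "\<exists>!w. w \<in> V \<and> (\<forall>z\<in>V. ip w z = f z)"
  proof (rule ex1I[of _ w])
    show "w \<in> V \<and> (\<forall>z\<in>V. ip w z = f z)" using w by simp
    fix u assume u: "u \<in> V \<and> (\<forall>z\<in>V. ip u z = f z)"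
    let ?d = "u + (-1) *\<^sub>R w"
    have nw: "(-1) *\<^sub>R w \<in> V"
      using w(1) b(2) span_scale[of w b "-1"] by simp
    then have d: "?d \<in> V"
      using u b(2) span_add[of u b "(-1) *\<^sub>R w"] by simp
    have "ip ?d ?d = ip u ?d + ip ((-1) *\<^sub>R w) ?d"
      using addl[OF _ nw d] u by blast
    also have "ip ((-1) *\<^sub>R w) ?d = - ip w ?d"
      using scl[OF w(1) w(1) d, of "-1"] by simp
    finally have "ip ?d ?d = 0" using u w d by simp
    then have "?d = 0" using sp d by (metis less_irrefl)
    then show "u = w" by simp
  qed
qed

section \<open>Left symmetric algebras with positive definite Koszul form\<close>

definition associator :: "('a \<Rightarrow> 'a \<Rightarrow> 'a) \<Rightarrow> 'a \<Rightarrow> 'a \<Rightarrow> 'a \<Rightarrow> 'a::real_vector" where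
  "associator m X Y Z = m (m X Y) Z - m X (m Y Z)"

definition left_symmetric_algebra :: "'a::real_vector set \<Rightarrow> ('a \<Rightarrow> 'a \<Rightarrow> 'a) \<Rightarrow> bool" where
  "left_symmetric_algebra g m \<longleftrightarrow>
     fin_dim_subspace g \<and> bilinear_on g g g m \<and>
     (\<forall>X\<in>g. \<forall>Y\<in>g. \<forall>Z\<in>g. associator m X Y Z = associator m Y X Z)"

definition koszul_form ::
  "'a::real_vector set \<Rightarrow> ('a \<Rightarrow> 'a \<Rightarrow> 'a) \<Rightarrow> 'a \<Rightarrow> 'a \<Rightarrow> real" where
  "koszul_form g m X Y = trace_on g (\<lambda>Z. m (m X Y) Z)"

definition LSPK :: "'a::real_vector set \<Rightarrow> ('a \<Rightarrow> 'a \<Rightarrow> 'a) \<Rightarrow> bool" where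
  "LSPK g m \<longleftrightarrow>
     left_symmetric_algebra g m \<and> g \<noteq> {0} \<and> scalar_product_on g (koszul_form g m)"

definition algebra_isomorphic ::
  "'a::real_vector set \<Rightarrow> ('a \<Rightarrow> 'a \<Rightarrow> 'a) \<Rightarrow> 'b::real_vector set \<Rightarrow> ('b \<Rightarrow> 'b \<Rightarrow> 'b) \<Rightarrow> bool" where
  "algebra_isomorphic g m g' m' \<longleftrightarrow>
     (\<exists>\<phi>. linear_on g g' \<phi> \<and> bij_betw \<phi> g g' \<and> (\<forall>X\<in>g. \<forall>Y\<in>g. \<phi> (m X Y) = m' (\<phi> X) (\<phi> Y)))"

section \<open>The construction data\<close>

definition omega1 ::
  "('a::real_vector \<Rightarrow> 'a \<Rightarrow> real) \<Rightarrow> 'b::real_vector set \<Rightarrow> ('b \<Rightarrow> 'b \<Rightarrow> real) \<Rightarrow>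
   ('b \<Rightarrow> 'a \<Rightarrow> 'a) \<Rightarrow> 'a \<Rightarrow> 'a \<Rightarrow> 'b" where
  "omega1 ip1 h2 ip2 \<rho>2 X Y = riesz_on h2 ip2 (\<lambda>Z. ip1 (\<rho>2 Z X) Y + ip1 (\<rho>2 Z Y) X)"

definition omega2 ::
  "'a::real_vector set \<Rightarrow> ('a \<Rightarrow> 'a \<Rightarrow> real) \<Rightarrow> ('b::real_vector \<Rightarrow> 'b \<Rightarrow> real) \<Rightarrow>
   ('a \<Rightarrow> 'b \<Rightarrow> 'b) \<Rightarrow> 'b \<Rightarrow> 'b \<Rightarrow> 'a" where
  "omega2 h1 ip1 ip2 \<rho>1 X Y = riesz_on h1 ip1 (\<lambda>Z. ip2 (\<rho>1 Z X) Y + ip2 (\<rho>1 Z Y) X)"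

locale lspk_predata =
  fixes h1 :: "'a::real_vector set" and ip1 :: "'a \<Rightarrow> 'a \<Rightarrow> real"
    and h2 :: "'b::real_vector set" and m2 :: "'b \<Rightarrow> 'b \<Rightarrow> 'b" (infixl \<open>\<circ>\<^sub>2\<close> 70)
    and ip2 :: "'b \<Rightarrow> 'b \<Rightarrow> real"
    and B1 :: "'a \<Rightarrow> 'a" and B2 :: "'b \<Rightarrow> 'b"
    and \<rho>1 :: "'a \<Rightarrow> 'b \<Rightarrow> 'b" and \<rho>2 :: "'b \<Rightarrow> 'a \<Rightarrow> 'a"
  assumes h1: "fin_dim_subspace h1" and ip1: "scalar_product_on h1 ip1"
    and h2: "fin_dim_subspace h2" and ip2: "scalar_product_on h2 ip2"
    and m2: "bilinear_on h2 h2 h2 (\<circ>\<^sub>2)"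
    and B1: "linear_on h1 h1 B1"
    and B1_skew: "\<And>X Y. X \<in> h1 \<Longrightarrow> Y \<in> h1 \<Longrightarrow> ip1 (B1 X) Y = - ip1 X (B1 Y)"
    and B2: "linear_on h2 h2 B2"
    and B2_skew: "\<And>X Y. X \<in> h2 \<Longrightarrow> Y \<in> h2 \<Longrightarrow> ip2 (B2 X) Y = - ip2 X (B2 Y)"
    \<comment> \<open>bilinearity of \<open>(X, Y) \<mapsto> \<rho>1 X Y\<close> says that \<open>\<rho>1\<close> is a linear map into \<open>End h2\<close>\<close>
    and \<rho>1: "bilinear_on h1 h2 h2 \<rho>1"
    and \<rho>2: "bilinear_on h2 h1 h1 \<rho>2"
begin

abbreviation \<omega>1 where "\<omega>1 \<equiv> omega1 ip1 h2 ip2 \<rho>2"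
abbreviation \<omega>2 where "\<omega>2 \<equiv> omega2 h1 ip1 ip2 \<rho>1"

lemma omega1:
  assumes "X \<in> h1" "Y \<in> h1"
  shows "\<omega>1 X Y \<in> h2 \<and> (\<forall>Z\<in>h2. ip2 (\<omega>1 X Y) Z = ip1 (\<rho>2 Z X) Y + ip1 (\<rho>2 Z Y) X)"
  unfolding omega1_def using assms ip1 \<rho>2
  by (intro riesz_on h2 ip2)
    (auto simp: scalar_product_on_def bilinear_on_def linear_on_def algebra_simps)

lemma omega2:
  assumes "X \<in> h2" "Y \<in> h2"
  shows "\<omega>2 X Y \<in> h1 \<and> (\<forall>Z\<in>h1. ip1 (\<omega>2 X Y) Z = ip2 (\<rho>1 Z X) Y + ip2 (\<rho>1 Z Y) X)"
  unfolding omega2_def using assms ip2 \<rho>1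
  by (intro riesz_on h1 ip1)
    (auto simp: scalar_product_on_def bilinear_on_def linear_on_def algebra_simps)

end

locale lspk_data = lspk_predata +
  assumes tr_\<rho>1: "\<And>X. X \<in> h1 \<Longrightarrow> trace_on h2 (\<rho>1 X) = 0"
    and \<rho>1_comm: "\<And>X Y Z. X \<in> h1 \<Longrightarrow> Y \<in> h1 \<Longrightarrow> Z \<in> h2 \<Longrightarrow>
      \<rho>1 X (\<rho>1 Y Z) - \<rho>1 Y (\<rho>1 X Z) = 0"
    and \<rho>2_rep: "\<And>X Y Z. X \<in> h2 \<Longrightarrow> Y \<in> h2 \<Longrightarrow> Z \<in> h1 \<Longrightarrow>
      \<rho>2 (X \<circ>\<^sub>2 Y - Y \<circ>\<^sub>2 X) Z = \<rho>2 X (\<rho>2 Y Z) - \<rho>2 Y (\<rho>2 X Z)"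
    and S2_1: "\<And>X Y Z. X \<in> h2 \<Longrightarrow> Y \<in> h2 \<Longrightarrow> Z \<in> h2 \<Longrightarrow>
      ip2 (X \<circ>\<^sub>2 Y - Y \<circ>\<^sub>2 X) Z = ip2 (Y \<circ>\<^sub>2 Z) X - ip2 (X \<circ>\<^sub>2 Z) Y"
    and S2_2: "\<And>X Y Z. X \<in> h2 \<Longrightarrow> Y \<in> h2 \<Longrightarrow> Z \<in> h2 \<Longrightarrow>
      associator (\<circ>\<^sub>2) X Y Z - associator (\<circ>\<^sub>2) Y X Z = ip2 Y Z *\<^sub>R X - ip2 X Z *\<^sub>R Y"
    and S2_3: "\<And>X Y. X \<in> h2 \<Longrightarrow> Y \<in> h2 \<Longrightarrow> B2 (X \<circ>\<^sub>2 Y) = B2 X \<circ>\<^sub>2 Y + X \<circ>\<^sub>2 B2 Y"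
    and S2_4: "\<And>X Y. X \<in> h2 \<Longrightarrow> Y \<in> h2 \<Longrightarrow> ip2 (B2 X) Y = - ip2 (B2 Y) X"
    and S2_5: "\<And>X. X \<in> h2 \<Longrightarrow> trace_on h2 (\<lambda>Y. X \<circ>\<^sub>2 Y) = - trace_on h1 (\<rho>2 X)"
    and S3_1: "\<And>X Y Z. X \<in> h1 \<Longrightarrow> Y \<in> h2 \<Longrightarrow> Z \<in> h2 \<Longrightarrow>
      \<rho>1 X (Y \<circ>\<^sub>2 Z) = Y \<circ>\<^sub>2 \<rho>1 X Z + \<rho>1 X Y \<circ>\<^sub>2 Z - \<rho>1 (\<rho>2 Y X) Z - \<omega>1 X (\<omega>2 Y Z)"
    and S3_2: "\<And>X Y Z. X \<in> h2 \<Longrightarrow> Y \<in> h1 \<Longrightarrow> Z \<in> h1 \<Longrightarrow>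
      \<rho>2 (\<rho>1 Y X) Z + \<omega>2 X (\<omega>1 Y Z) = 0"
    and S3_3: "\<And>X Y Z. X \<in> h1 \<Longrightarrow> Y \<in> h1 \<Longrightarrow> Z \<in> h1 \<Longrightarrow>
      \<rho>1 X (\<omega>1 Y Z) - \<rho>1 Y (\<omega>1 X Z) = 0"
    and S3_4: "\<And>X Y Z. X \<in> h2 \<Longrightarrow> Y \<in> h2 \<Longrightarrow> Z \<in> h2 \<Longrightarrow>
      \<rho>2 X (\<omega>2 Y Z) - \<rho>2 Y (\<omega>2 X Z) + \<omega>2 X (Y \<circ>\<^sub>2 Z) - \<omega>2 Y (X \<circ>\<^sub>2 Z)
        - \<omega>2 (X \<circ>\<^sub>2 Y - Y \<circ>\<^sub>2 X) Z = 0"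
    and S3_5: "\<And>X Y Z. X \<in> h1 \<Longrightarrow> Y \<in> h2 \<Longrightarrow> Z \<in> h2 \<Longrightarrow>
      \<omega>2 (\<rho>1 X Y) Z + \<omega>2 Y (\<rho>1 X Z) = 0"
    and S3_6: "\<And>X Y Z. X \<in> h2 \<Longrightarrow> Y \<in> h1 \<Longrightarrow> Z \<in> h1 \<Longrightarrow>
      X \<circ>\<^sub>2 \<omega>1 Y Z = \<omega>1 (\<rho>2 X Y) Z + \<omega>1 Y (\<rho>2 X Z) - ip1 Y Z *\<^sub>R X"
    and S3_7: "\<And>X Y. X \<in> h1 \<Longrightarrow> Y \<in> h2 \<Longrightarrow>
      B2 (\<rho>1 X Y) - \<rho>1 X (B2 Y) = \<rho>1 (B1 X) Y + (1/2) *\<^sub>R \<rho>1 X Y"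
    and S3_8: "\<And>X Y. X \<in> h2 \<Longrightarrow> Y \<in> h1 \<Longrightarrow>
      B1 (\<rho>2 X Y) - \<rho>2 X (B1 Y) = \<rho>2 (B2 X) Y"

text \<open>
  The algebra \<open>h1 \<oplus> h2 \<oplus> \<real>H\<close> is modelled on triples, with \<open>(x, 0, 0)\<close>, \<open>(0, x, 0)\<close> and
  \<open>(0, 0, t)\<close> standing for \<open>x \<in> h1\<close>, \<open>x \<in> h2\<close> and \<open>t H\<close>.  Its product is the bilinear
  extension of the case-by-case definition, see \<open>lspk_prod_cases\<close> below.
\<close>

definition lspk_carrier :: "'a::real_vector set \<Rightarrow> 'b::real_vector set \<Rightarrow> ('a \<times> 'b \<times> real) set" where
  "lspk_carrier h1 h2 = h1 \<times> h2 \<times> UNIV"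

definition lspk_prod ::
  "'a::real_vector set \<Rightarrow> ('a \<Rightarrow> 'a \<Rightarrow> real) \<Rightarrow> 'b::real_vector set \<Rightarrow> ('b \<Rightarrow> 'b \<Rightarrow> 'b) \<Rightarrow>
   ('b \<Rightarrow> 'b \<Rightarrow> real) \<Rightarrow> ('a \<Rightarrow> 'a) \<Rightarrow> ('b \<Rightarrow> 'b) \<Rightarrow> ('a \<Rightarrow> 'b \<Rightarrow> 'b) \<Rightarrow> ('b \<Rightarrow> 'a \<Rightarrow> 'a) \<Rightarrow>
   'a \<times> 'b \<times> real \<Rightarrow> 'a \<times> 'b \<times> real \<Rightarrow> 'a \<times> 'b \<times> real" where
  "lspk_prod h1 ip1 h2 m2 ip2 B1 B2 \<rho>1 \<rho>2 = (\<lambda>(x1, x2, s) (y1, y2, t).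
     (omega2 h1 ip1 ip2 \<rho>1 x2 y2 + \<rho>2 x2 y1 + s *\<^sub>R (B1 y1 + (1/2) *\<^sub>R y1),
      omega1 ip1 h2 ip2 \<rho>2 x1 y1 + m2 x2 y2 + \<rho>1 x1 y2 + s *\<^sub>R (B2 y2 + y2) + t *\<^sub>R x2,
      ip1 x1 y1 + ip2 x2 y2 + s * t))"

context lspk_predata
begin

abbreviation lspk_mult (infixl \<open>\<bullet>\<^sub>g\<close> 70) where
  "lspk_mult \<equiv> lspk_prod h1 ip1 h2 m2 ip2 B1 B2 \<rho>1 \<rho>2"

lemma zero_laws:
  "0 \<in> h1" "0 \<in> h2" "B1 0 = 0" "B2 0 = 0"
  "X \<in> h1 \<Longrightarrow> \<rho>1 X 0 = 0" "Y \<in> h2 \<Longrightarrow> \<rho>2 Y 0 = 0"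
  "Y \<in> h2 \<Longrightarrow> \<rho>1 0 Y = 0" "X \<in> h1 \<Longrightarrow> \<rho>2 0 X = 0"
  "Y \<in> h2 \<Longrightarrow> Y \<circ>\<^sub>2 0 = 0" "Y \<in> h2 \<Longrightarrow> 0 \<circ>\<^sub>2 Y = 0"
  "X \<in> h1 \<Longrightarrow> ip1 X 0 = 0" "X \<in> h1 \<Longrightarrow> ip1 0 X = 0"
  "Y \<in> h2 \<Longrightarrow> ip2 Y 0 = 0" "Y \<in> h2 \<Longrightarrow> ip2 0 Y = 0"
proof -
  show z: "0 \<in> h1" "0 \<in> h2"
    using h1 h2 span_zero unfolding fin_dim_subspace_def by blast+
  have l0: "f 0 = 0" if "linear_on V W f" "0 \<in> V"
    for V :: "'x::real_vector set" and W :: "'y::real_vector set" and f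
    using that unfolding linear_on_def by (metis scale_zero_left)
  show "B1 0 = 0" "B2 0 = 0" using l0[OF B1 z(1)] l0[OF B2 z(2)] by auto
  show "X \<in> h1 \<Longrightarrow> \<rho>1 X 0 = 0" "Y \<in> h2 \<Longrightarrow> \<rho>1 0 Y = 0"
    using \<rho>1 z unfolding bilinear_on_def
    by (auto intro: l0[of h2 h2 "\<rho>1 X"] l0[of h1 h2 "\<lambda>x. \<rho>1 x Y"])
  show "Y \<in> h2 \<Longrightarrow> \<rho>2 Y 0 = 0" "X \<in> h1 \<Longrightarrow> \<rho>2 0 X = 0"
    using \<rho>2 z unfolding bilinear_on_def
    by (auto intro: l0[of h1 h1 "\<rho>2 Y"] l0[of h2 h1 "\<lambda>x. \<rho>2 x X"])
  show "Y \<in> h2 \<Longrightarrow> Y \<circ>\<^sub>2 0 = 0" "Y \<in> h2 \<Longrightarrow> 0 \<circ>\<^sub>2 Y = 0"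
    using m2 z unfolding bilinear_on_def
    by (auto intro: l0[of h2 h2 "m2 Y"] l0[of h2 h2 "\<lambda>x. m2 x Y"])
  show "X \<in> h1 \<Longrightarrow> ip1 X 0 = 0" "X \<in> h1 \<Longrightarrow> ip1 0 X = 0"
    using ip1 z unfolding bilinear_on_def scalar_product_on_def
    by (auto intro: l0[of h1 UNIV "ip1 X"] l0[of h1 UNIV "\<lambda>x. ip1 x X"])
  show "Y \<in> h2 \<Longrightarrow> ip2 Y 0 = 0" "Y \<in> h2 \<Longrightarrow> ip2 0 Y = 0"
    using ip2 z unfolding bilinear_on_def scalar_product_on_def
    by (auto intro: l0[of h2 UNIV "ip2 Y"] l0[of h2 UNIV "\<lambda>x. ip2 x Y"])
qed

lemma omega_zero:
  "X \<in> h1 \<Longrightarrow> \<omega>1 X 0 = 0" "X \<in> h1 \<Longrightarrow> \<omega>1 0 X = 0"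
  "Y \<in> h2 \<Longrightarrow> \<omega>2 Y 0 = 0" "Y \<in> h2 \<Longrightarrow> \<omega>2 0 Y = 0"
proof -
  have pos1: "\<forall>w\<in>h1. w \<noteq> 0 \<longrightarrow> 0 < ip1 w w" and pos2: "\<forall>w\<in>h2. w \<noteq> 0 \<longrightarrow> 0 < ip2 w w"
    using ip1 ip2 by (simp_all add: scalar_product_on_def)
  have r1: "w = 0" if "w \<in> h1" "\<forall>z\<in>h1. ip1 w z = 0" for w
    using pos1 that by (metis less_irrefl)
  have r2: "w = 0" if "w \<in> h2" "\<forall>z\<in>h2. ip2 w z = 0" for w
    using pos2 that by (metis less_irrefl)
  have c1: "\<rho>1 X Y \<in> h2" if "X \<in> h1" "Y \<in> h2" for X Y
    using \<rho>1 that unfolding bilinear_on_def linear_on_def by blast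
  have c2: "\<rho>2 X Y \<in> h1" if "X \<in> h2" "Y \<in> h1" for X Y
    using \<rho>2 that unfolding bilinear_on_def linear_on_def by blast
  show "\<omega>1 X 0 = 0" "\<omega>1 0 X = 0" if "X \<in> h1"
    using r2[of "\<omega>1 X 0"] r2[of "\<omega>1 0 X"] omega1[of X 0] omega1[of 0 X] that
    by (simp_all add: zero_laws c2)
  show "\<omega>2 Y 0 = 0" "\<omega>2 0 Y = 0" if "Y \<in> h2"
    using r1[of "\<omega>2 Y 0"] r1[of "\<omega>2 0 Y"] omega2[of Y 0] omega2[of 0 Y] that
    by (simp_all add: zero_laws c1)
qed

lemma lspk_prod_cases:
  assumes "X1 \<in> h1" "Y1 \<in> h1" "X2 \<in> h2" "Y2 \<in> h2"
  shows
    "(X1, 0, 0) \<bullet>\<^sub>g (Y1, 0, 0) = (0, \<omega>1 X1 Y1, ip1 X1 Y1)"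
    "(0, X2, 0) \<bullet>\<^sub>g (0, Y2, 0) = (\<omega>2 X2 Y2, X2 \<circ>\<^sub>2 Y2, ip2 X2 Y2)"
    "(X1, 0, 0) \<bullet>\<^sub>g (0, Y2, 0) = (0, \<rho>1 X1 Y2, 0)"
    "(0, X2, 0) \<bullet>\<^sub>g (Y1, 0, 0) = (\<rho>2 X2 Y1, 0, 0)"
    "(0, 0, 1) \<bullet>\<^sub>g (X1, 0, 0) = (B1 X1 + (1/2) *\<^sub>R X1, 0, 0)"
    "(X1, 0, 0) \<bullet>\<^sub>g (0, 0, 1) = (0, 0, 0)"
    "(0, 0, 1) \<bullet>\<^sub>g (0, X2, 0) = (0, B2 X2 + X2, 0)"
    "(0, X2, 0) \<bullet>\<^sub>g (0, 0, 1) = (0, X2, 0)"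
    "(0, 0, 1) \<bullet>\<^sub>g (0, 0, 1) = (0, 0, 1)"
  using assms by (simp_all add: lspk_prod_def zero_laws omega_zero)

end

end

theory Submission
  imports Defs
begin

text \<open>
  Write \<open>G\<close> for \<open>h1 \<oplus> h2 \<oplus> \<real>H\<close> and \<open>\<langle>,\<rangle>\<close> for the orthogonal sum of the two scalar products and
  of the one on \<open>\<real>H\<close> with \<open>\<langle>H, H\<rangle> = 1\<close>.  Both halves of the theorem rest on one equivalence,
  \<open>lspk_data_iff\<close>: for data as in \<open>lspk_predata\<close>, the axioms of \<open>lspk_data\<close> hold if and
  only if the product on \<open>G\<close> is left symmetric and \<open>tr L\<^bsub>(x, a, s)\<^esub> = s \<rho>\<close>.  Left symmetry says
  that the trilinear map \<open>ass(X, Y, Z) - ass(Y, X, Z)\<close> vanishes.  It may be evaluated on elements of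
  \<open>h1\<close>, \<open>h2\<close> and on \<open>H\<close>; the resulting components are the conditions of the two systems, some
  identities that hold by the definition of \<open>\<omega>1\<close> and \<open>\<omega>2\<close>, and the two derivation rules
  \<open>\<omega>1_derivation\<close>, \<open>\<omega>2_derivation\<close>, which are the adjoints of the commutation rules of
  \<open>B1\<close> with \<open>\<rho>2\<close> and of \<open>B2\<close> with \<open>\<rho>1\<close>.

  The first half follows at once: the \<open>H\<close>-component of \<open>X \<bullet> Y\<close> is \<open>\<langle>X, Y\<rangle>\<close>, so the Koszul form
  \<open>tr L\<^bsub>X \<bullet> Y\<^esub>\<close> equals \<open>\<rho> \<langle>X, Y\<rangle>\<close>.

  For the second half let \<open>B\<close> be the Koszul form of an LSPK and let \<open>H\<close> represent the linear form
  \<open>X \<mapsto> tr L\<^sub>X\<close>, so that \<open>B(H, X \<bullet> Y) = B(X, Y)\<close>.  Applying \<open>B(H, _)\<close> to left symmetry gives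
  the Codazzi equation \<open>codazzi\<close>.  From it, \<open>S = R\<^sub>H\<close> is symmetric, \<open>S H = H\<close>, and
  \<open>L\<^sub>H + L\<^sub>H\<^sup>t = 1 + S\<close>.  Left symmetry with two arguments \<open>H\<close> reads \<open>[L\<^sub>H, S] = S - S\<^sup>2\<close>, and a trace
  argument (\<open>idempotent_of_commutator\<close>) forces both sides to vanish.  So \<open>S\<close> is an orthogonal
  projection which commutes with \<open>L\<^sub>H\<close>.  Take \<open>h1\<close> to be its kernel and \<open>h2\<close> the orthogonal
  complement of \<open>H\<close> in its image.  Then \<open>L\<^sub>H - (1 + S)/2\<close> is skew and provides \<open>B1\<close> and \<open>B2\<close>.
  That the products of homogeneous elements lie where the construction wants them follows from
  left symmetry with last argument \<open>H\<close>, except for \<open>h1 \<bullet> h1\<close>: its \<open>h1\<close>-part is a bilinear map on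
  which a skew operator acts with the eigenvalue 1/2, hence it is zero
  (\<open>skew_eigen_bilinear_zero\<close>).  The Codazzi equation identifies the remaining components with
  \<open>\<omega>1\<close> and \<open>\<omega>2\<close>.  Thus the algebra is isomorphic to \<open>G\<close> with the triple product, which is
  therefore left symmetric and has the right traces, and \<open>lspk_data_iff\<close> returns the axioms.
\<close>

section \<open>Linear maps on subspaces\<close>

lemma subspace_of_fin_dim: "fin_dim_subspace V \<Longrightarrow> subspace V"
  unfolding fin_dim_subspace_def by auto

lemma fin_dim_subspace_subset:
  assumes "fin_dim_subspace V" "subspace W" "W \<subseteq> V"
  shows "fin_dim_subspace W"
proof -
  obtain b where b: "finite b" "span b = V"
    using assms(1) unfolding fin_dim_subspace_def by blast
  obtain c where c: "c \<subseteq> W" "independent c" "W \<subseteq> span c"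
    using maximal_independent_subset[of W] by blast
  have "finite c"
    using independent_span_bound[OF b(1) c(2)] c(1) assms(3) b(2) by blast
  moreover have "span c = W"
    using c assms(2) by (metis span_minimal subset_antisym)
  ultimately show ?thesis unfolding fin_dim_subspace_def by blast
qed

lemma linear_on_mem: "linear_on V W f \<Longrightarrow> x \<in> V \<Longrightarrow> f x \<in> W"
  and linear_on_add: "linear_on V W f \<Longrightarrow> x \<in> V \<Longrightarrow> y \<in> V \<Longrightarrow> f (x + y) = f x + f y"
  and linear_on_scale: "linear_on V W f \<Longrightarrow> x \<in> V \<Longrightarrow> f (c *\<^sub>R x) = c *\<^sub>R f x"
  by (simp_all add: linear_on_def)

lemma linear_on_diff:
  assumes "linear_on V W f" "subspace V" "x \<in> V" "y \<in> V"
  shows "f (x - y) = f x - f y"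
  using linear_on_add[OF assms(1), of x "(-1) *\<^sub>R y"] linear_on_scale[OF assms(1), of y "-1"]
    subspace_scale[OF assms(2), of y "-1"] assms(3,4) by simp

lemma linear_on_0: "linear_on V W f \<Longrightarrow> subspace V \<Longrightarrow> f 0 = 0"
  using linear_on_scale[of V W f 0 0] by (simp add: subspace_0)

lemma linear_on_sum:
  assumes "linear_on V W f" "subspace V" "\<And>i. i \<in> A \<Longrightarrow> u i \<in> V"
  shows "f (\<Sum>i\<in>A. u i) = (\<Sum>i\<in>A. f (u i))"
  using assms(3)
proof (induction A rule: infinite_finite_induct)
  case (insert i A)
  then have "(\<Sum>i\<in>A. u i) \<in> V" by (intro subspace_sum[OF assms(2)]) auto
  then show ?case using insert by (simp add: linear_on_add[OF assms(1)])
qed (simp_all add: linear_on_0[OF assms(1,2)])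

lemma bilinear_on_linear:
  assumes "bilinear_on U V W f"
  shows "x \<in> U \<Longrightarrow> linear_on V W (f x)" "y \<in> V \<Longrightarrow> linear_on U W (\<lambda>x. f x y)"
  using assms by (auto simp: bilinear_on_def)

lemma bilinear_onI:
  assumes "\<And>x y. x \<in> U \<Longrightarrow> y \<in> V \<Longrightarrow> f x y \<in> W"
    and "\<And>x y z. x \<in> U \<Longrightarrow> y \<in> U \<Longrightarrow> z \<in> V \<Longrightarrow> f (x + y) z = f x z + f y z"
    and "\<And>x y z. x \<in> U \<Longrightarrow> y \<in> V \<Longrightarrow> z \<in> V \<Longrightarrow> f x (y + z) = f x y + f x z"
    and "\<And>c x y. x \<in> U \<Longrightarrow> y \<in> V \<Longrightarrow> f (c *\<^sub>R x) y = c *\<^sub>R f x y"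
    and "\<And>c x y. x \<in> U \<Longrightarrow> y \<in> V \<Longrightarrow> f x (c *\<^sub>R y) = c *\<^sub>R f x y"
  shows "bilinear_on U V W f"
  using assms by (auto simp: bilinear_on_def linear_on_def)

section \<open>Euclidean subspaces\<close>

locale euclidean_on =
  fixes V :: "'v::real_vector set" and ip :: "'v \<Rightarrow> 'v \<Rightarrow> real"
  assumes fin_dim: "fin_dim_subspace V" and sp: "scalar_product_on V ip"
begin

lemma subspace: "subspace V"
  using fin_dim by (rule subspace_of_fin_dim)

lemma mem [simp, intro]:
  "0 \<in> V" "x \<in> V \<Longrightarrow> y \<in> V \<Longrightarrow> x + y \<in> V" "x \<in> V \<Longrightarrow> c *\<^sub>R x \<in> V"
  "x \<in> V \<Longrightarrow> y \<in> V \<Longrightarrow> x - y \<in> V" "x \<in> V \<Longrightarrow> - x \<in> V"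
  using subspace
  by (auto intro: subspace_0 subspace_add subspace_scale subspace_diff subspace_neg)

lemma bilinear: "bilinear_on V V UNIV ip"
  using sp by (simp add: scalar_product_on_def)

lemma ip_commute: "x \<in> V \<Longrightarrow> y \<in> V \<Longrightarrow> ip x y = ip y x"
  using sp by (simp add: scalar_product_on_def)

lemma ip_pos: "x \<in> V \<Longrightarrow> x \<noteq> 0 \<Longrightarrow> 0 < ip x x"
  using sp by (simp add: scalar_product_on_def)

lemmas ip_linear = bilinear_on_linear[OF bilinear]

lemma ip_left [simp]:
  assumes "z \<in> V"
  shows "x \<in> V \<Longrightarrow> y \<in> V \<Longrightarrow> ip (x + y) z = ip x z + ip y z"
    "x \<in> V \<Longrightarrow> ip (c *\<^sub>R x) z = c * ip x z"
    "x \<in> V \<Longrightarrow> y \<in> V \<Longrightarrow> ip (x - y) z = ip x z - ip y z" "ip 0 z = 0"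
    "x \<in> V \<Longrightarrow> ip (- x) z = - ip x z"
  using linear_on_add[OF ip_linear(2)[OF assms]] linear_on_scale[OF ip_linear(2)[OF assms]]
    linear_on_diff[OF ip_linear(2)[OF assms] subspace] linear_on_0[OF ip_linear(2)[OF assms] subspace]
    linear_on_scale[OF ip_linear(2)[OF assms], of x "-1"]
  by auto

lemma ip_right [simp]:
  assumes "z \<in> V"
  shows "x \<in> V \<Longrightarrow> y \<in> V \<Longrightarrow> ip z (x + y) = ip z x + ip z y"
    "x \<in> V \<Longrightarrow> ip z (c *\<^sub>R x) = c * ip z x"
    "x \<in> V \<Longrightarrow> y \<in> V \<Longrightarrow> ip z (x - y) = ip z x - ip z y" "ip z 0 = 0"
    "x \<in> V \<Longrightarrow> ip z (- x) = - ip z x"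
  using linear_on_add[OF ip_linear(1)[OF assms]] linear_on_scale[OF ip_linear(1)[OF assms]]
    linear_on_diff[OF ip_linear(1)[OF assms] subspace] linear_on_0[OF ip_linear(1)[OF assms] subspace]
    linear_on_scale[OF ip_linear(1)[OF assms], of x "-1"]
  by auto

lemma ip_nonneg: "x \<in> V \<Longrightarrow> 0 \<le> ip x x"
  using ip_pos[of x] by (cases "x = 0") auto

lemma ip_eq_0_iff: "x \<in> V \<Longrightarrow> ip x x = 0 \<longleftrightarrow> x = 0"
  using ip_pos[of x] by (cases "x = 0") auto

lemma ip_eqI:
  assumes "x \<in> V" "y \<in> V" "\<And>z. z \<in> V \<Longrightarrow> ip x z = ip y z"
  shows "x = y"
proof -
  have "ip (x - y) (x - y) = 0" using assms by simp
  then show ?thesis using assms ip_eq_0_iff[of "x - y"] by simp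
qed

text \<open>
  Both the orthonormality relations and the expansion of every vector are demanded, so that
  coordinates are available without passing through \<open>span\<close> and \<open>representation\<close>.
\<close>

definition orthonormal_basis :: "'v set \<Rightarrow> bool" where
  "orthonormal_basis b \<longleftrightarrow> finite b \<and> b \<subseteq> V \<and>
     (\<forall>e\<in>b. \<forall>e'\<in>b. ip e e' = (if e = e' then 1 else 0)) \<and>
     (\<forall>x\<in>V. x = (\<Sum>e\<in>b. ip x e *\<^sub>R e))"

lemma orthonormal_basisD:
  assumes "orthonormal_basis b"
  shows "finite b" "b \<subseteq> V" "e \<in> b \<Longrightarrow> e \<in> V"
    "e \<in> b \<Longrightarrow> e' \<in> b \<Longrightarrow> ip e e' = (if e = e' then 1 else 0)"
    "x \<in> V \<Longrightarrow> x = (\<Sum>e\<in>b. ip x e *\<^sub>R e)"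
  using assms unfolding orthonormal_basis_def by blast+

lemma orthonormal_basis_span:
  assumes "orthonormal_basis b"
  shows "independent b" "span b = V"
proof -
  note b = orthonormal_basisD[OF assms]
  show "span b = V"
  proof
    show "span b \<subseteq> V" using b(2) subspace by (rule span_minimal)
    show "V \<subseteq> span b"
    proof
      fix x assume "x \<in> V"
      then show "x \<in> span b"
        using b(5)[of x] by (metis (no_types, lifting) span_base span_scale span_sum)
    qed
  qed
  show "independent b"
  proof (rule independent_if_scalars_zero[OF b(1)])
    fix u e assume 0: "(\<Sum>x\<in>b. u x *\<^sub>R x) = 0" and e: "e \<in> b"
    have "0 = ip (\<Sum>x\<in>b. u x *\<^sub>R x) e" using 0 e b(3) by simp
    also have "\<dots> = (\<Sum>x\<in>b. ip (u x *\<^sub>R x) e)"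
      using b(3) e by (intro linear_on_sum[OF ip_linear(2) subspace]) auto
    also have "\<dots> = (\<Sum>x\<in>b. if x = e then u x else 0)"
      using b(3,4) e by (intro sum.cong) auto
    also have "\<dots> = u e" using b(1) e by simp
    finally show "u e = 0" by simp
  qed
qed

lemma card_orthonormal_basis: "orthonormal_basis b \<Longrightarrow> card b = dim V"
  using orthonormal_basis_span dim_eq_card_independent dim_span by metis

lemma representation_orthonormal_basis:
  assumes "orthonormal_basis b" "x \<in> V" "e \<in> b"
  shows "representation b x e = ip x e"
proof -
  note b = orthonormal_basisD[OF assms(1)] and s = orthonormal_basis_span[OF assms(1)]
  have "x = (\<Sum>k\<in>b. representation b x k *\<^sub>R k)"
    using sum_representation_eq[OF s(1), of x b] s(2) b(1) assms(2) by simp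
  then have "ip x e = ip (\<Sum>k\<in>b. representation b x k *\<^sub>R k) e" by simp
  also have "\<dots> = (\<Sum>k\<in>b. ip (representation b x k *\<^sub>R k) e)"
    using b(3) assms(3) by (intro linear_on_sum[OF ip_linear(2) subspace]) auto
  also have "\<dots> = (\<Sum>k\<in>b. if k = e then representation b x k else 0)"
    using b(3,4) assms(3) by (intro sum.cong) auto
  also have "\<dots> = representation b x e" using b(1) assms(3) by simp
  finally show ?thesis by simp
qed

lemma trace_on_orthonormal_basis:
  assumes "linear_on V V f" "orthonormal_basis b"
  shows "trace_on V f = (\<Sum>e\<in>b. ip (f e) e)"
  unfolding trace_on_eq[OF assms(1) orthonormal_basisD(1)[OF assms(2)] orthonormal_basis_span[OF assms(2)]]
  using assms orthonormal_basisD[OF assms(2)]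
  by (intro sum.cong refl representation_orthonormal_basis) (auto intro: linear_on_mem)

end

lemma euclidean_on_subspace:
  assumes "euclidean_on V ip" "subspace W" "W \<subseteq> V"
  shows "euclidean_on W ip"
proof -
  interpret euclidean_on V ip by fact
  show ?thesis
    using fin_dim_subspace_subset[OF fin_dim assms(2,3)] sp assms(3)
    by unfold_locales (auto simp: scalar_product_on_def bilinear_on_def linear_on_def subset_iff)
qed

text \<open>
  Gram and Schmidt: the normalized difference between a new vector and its projection onto the
  span of the old basis extends that basis.
\<close>

lemma orthonormal_basis_exists_span:
  assumes "finite b" "euclidean_on (span b) ip"
  shows "\<exists>c. euclidean_on.orthonormal_basis (span b) ip c"
  using assms
proof (induction b rule: finite_induct)
  case empty
  then interpret euclidean_on "span {}" ip .
  have "orthonormal_basis {}" unfolding orthonormal_basis_def by auto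
  then show ?case by blast
next
  case (insert a b)
  interpret W: euclidean_on "span (insert a b)" ip by (fact insert.prems)
  have sub: "span b \<subseteq> span (insert a b)" by (rule span_mono) auto
  interpret U: euclidean_on "span b" ip
    using euclidean_on_subspace[OF insert.prems subspace_span sub] .
  obtain c where c: "U.orthonormal_basis c" using insert.IH U.euclidean_on_axioms by blast
  note cD = U.orthonormal_basisD[OF c]
  show ?case
  proof (cases "a \<in> span b")
    case True
    then have "span (insert a b) = span b" by (rule span_redundant)
    then show ?thesis using c by auto
  next
    case False
    define p where "p = (\<Sum>e\<in>c. ip a e *\<^sub>R e)"
    have p: "p \<in> span b" unfolding p_def using cD(3) by (intro span_sum span_scale) auto
    have aW: "a \<in> span (insert a b)" by (simp add: span_base)
    have cW: "e \<in> span (insert a b)" if "e \<in> c" for e using cD(3)[OF that] sub by blast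
    define d where "d = a - p"
    have dW: "d \<in> span (insert a b)" unfolding d_def using aW p sub by blast
    have d0: "d \<noteq> 0" using False p unfolding d_def by auto
    have dc: "ip d e = 0" if e: "e \<in> c" for e
    proof -
      have "ip p e = (\<Sum>k\<in>c. ip (ip a k *\<^sub>R k) e)"
        unfolding p_def using cD(3) e
        by (intro linear_on_sum[OF U.ip_linear(2) U.subspace]) auto
      also have "\<dots> = (\<Sum>k\<in>c. if k = e then ip a k else 0)"
        using cD(3,4) e by (intro sum.cong) auto
      also have "\<dots> = ip a e" using cD(1) e by simp
      finally show ?thesis unfolding d_def using aW p sub cW[OF e] by (simp add: subsetD)
    qed
    define u where "u = (1 / sqrt (ip d d)) *\<^sub>R d"
    have uW: "u \<in> span (insert a b)" unfolding u_def using dW by auto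
    have dpos: "0 < ip d d" using W.ip_pos[OF dW d0] .
    have uu: "ip u u = 1" unfolding u_def using dW dpos by (simp add: field_simps)
    have uc: "ip u e = 0" "ip e u = 0" if "e \<in> c" for e
      using dc[OF that] dW cW[OF that] W.ip_commute[OF cW[OF that] uW] unfolding u_def by auto
    have unc: "u \<notin> c" using uu uc(1) by fastforce
    have "W.orthonormal_basis (insert u c)"
      unfolding W.orthonormal_basis_def
    proof (intro conjI ballI)
      show "finite (insert u c)" using cD(1) by simp
      show "insert u c \<subseteq> span (insert a b)" using uW cW by auto
      fix e e' assume "e \<in> insert u c" "e' \<in> insert u c"
      then show "ip e e' = (if e = e' then 1 else 0)"
        using uu uc unc cD(4)[of e e'] by auto
    next
      fix x assume x: "x \<in> span (insert a b)"
      obtain k where k: "x - k *\<^sub>R a \<in> span b" using x by (auto simp: span_insert)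
      define y where "y = (x - k *\<^sub>R a) + k *\<^sub>R p"
      have y: "y \<in> span b" unfolding y_def using k p by (intro span_add span_scale)
      define t where "t = k * sqrt (ip d d)"
      have "x = y + k *\<^sub>R d" unfolding y_def d_def by (simp add: algebra_simps)
      then have xe: "x = y + t *\<^sub>R u" unfolding t_def u_def using dpos by simp
      have yW: "y \<in> span (insert a b)" using y sub by blast
      have ye: "y = (\<Sum>e\<in>c. ip y e *\<^sub>R e)" by (rule cD(5)[OF y])
      have "ip u y = ip u (\<Sum>e\<in>c. ip y e *\<^sub>R e)" using ye by simp
      also have "\<dots> = (\<Sum>e\<in>c. ip u (ip y e *\<^sub>R e))"
        using cW uW by (intro linear_on_sum[OF W.ip_linear(1) W.subspace]) auto
      also have "\<dots> = 0" using cW uW uc by (intro sum.neutral) auto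
      finally have "ip y u = 0" using W.ip_commute uW yW by simp
      then have xu: "ip x u = t" unfolding xe using yW uW uu by simp
      have "ip x e = ip y e" if "e \<in> c" for e
        unfolding xe using yW uW cW[OF that] uc[OF that] by simp
      then have "(\<Sum>e\<in>c. ip x e *\<^sub>R e) = y" using ye by simp
      then show "x = (\<Sum>e\<in>insert u c. ip x e *\<^sub>R e)"
        using unc cD(1) xu xe by simp
    qed
    then show ?thesis by blast
  qed
qed

context euclidean_on
begin

lemma orthonormal_basis_exists: "\<exists>b. orthonormal_basis b"
  using orthonormal_basis_exists_span[of _ ip] fin_dim euclidean_on_axioms
  unfolding fin_dim_subspace_def by blast

text \<open>
  In coordinates, moving \<open>T\<close> from one slot to the other transposes its matrix.  The sums
  replace traces of products of operators; for \<open>\<beta> x y = ip x (U y)\<close> the lemma is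
  \<open>tr(U\<^sup>t T) = tr(T U\<^sup>t)\<close>.
\<close>

lemma sum_adjoint:
  assumes b: "orthonormal_basis b"
    and T: "\<And>x. x \<in> V \<Longrightarrow> T x \<in> V" and T': "\<And>x. x \<in> V \<Longrightarrow> T' x \<in> V"
    and adj: "\<And>x y. x \<in> V \<Longrightarrow> y \<in> V \<Longrightarrow> ip (T x) y = ip x (T' y)"
    and \<beta>: "bilinear_on V V UNIV \<beta>"
  shows "(\<Sum>e\<in>b. \<beta> (T e) e) = (\<Sum>e\<in>b. \<beta> e (T' e) :: real)"
proof -
  note bD = orthonormal_basisD[OF b]
  note \<beta>l = bilinear_on_linear[OF \<beta>]
  have "(\<Sum>e\<in>b. \<beta> (T e) e) = (\<Sum>e\<in>b. \<beta> (\<Sum>k\<in>b. ip (T e) k *\<^sub>R k) e)"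
    using bD(3,5) T by (intro sum.cong refl) (metis (no_types))
  also have "\<dots> = (\<Sum>e\<in>b. \<Sum>k\<in>b. \<beta> (ip (T e) k *\<^sub>R k) e)"
    using bD(3) by (intro sum.cong refl linear_on_sum[OF \<beta>l(2) subspace]) auto
  also have "\<dots> = (\<Sum>e\<in>b. \<Sum>k\<in>b. \<beta> k (ip (T' k) e *\<^sub>R e))"
  proof (intro sum.cong refl)
    fix e k assume ek: "e \<in> b" "k \<in> b"
    have "ip (T e) k = ip (T' k) e"
      using adj[of e k] ip_commute[of "T' k" e] ek bD(3) T' by simp
    then show "\<beta> (ip (T e) k *\<^sub>R k) e = \<beta> k (ip (T' k) e *\<^sub>R e)"
      using linear_on_scale[OF \<beta>l(2)] linear_on_scale[OF \<beta>l(1)] ek bD(3) by simp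
  qed
  also have "\<dots> = (\<Sum>k\<in>b. \<Sum>e\<in>b. \<beta> k (ip (T' k) e *\<^sub>R e))" by (rule sum.swap)
  also have "\<dots> = (\<Sum>k\<in>b. \<beta> k (\<Sum>e\<in>b. ip (T' k) e *\<^sub>R e))"
    using bD(3) by (intro sum.cong refl linear_on_sum[OF \<beta>l(1) subspace, symmetric]) auto
  also have "\<dots> = (\<Sum>k\<in>b. \<beta> k (T' k))"
    using bD(3,5) T' by (intro sum.cong refl) (metis (no_types))
  finally show ?thesis .
qed

text \<open>
  A skew operator is trace-orthogonal to every symmetric form.
\<close>

lemma sum_skew:
  assumes b: "orthonormal_basis b" and A: "linear_on V V A"
    and skew: "\<And>x y. x \<in> V \<Longrightarrow> y \<in> V \<Longrightarrow> ip (A x) y = - ip x (A y)"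
    and \<beta>: "bilinear_on V V UNIV \<beta>" and sym: "\<And>x y. x \<in> V \<Longrightarrow> y \<in> V \<Longrightarrow> \<beta> x y = \<beta> y x"
  shows "(\<Sum>e\<in>b. \<beta> (A e) e) = (0::real)"
proof -
  note bD = orthonormal_basisD[OF b] and Am = linear_on_mem[OF A]
  have "(\<Sum>e\<in>b. \<beta> (A e) e) = (\<Sum>e\<in>b. \<beta> e ((-1) *\<^sub>R A e))"
    using Am skew by (intro sum_adjoint[OF b _ _ _ \<beta>]) auto
  also have "\<dots> = (\<Sum>e\<in>b. - \<beta> (A e) e)"
    using linear_on_scale[OF bilinear_on_linear(1)[OF \<beta>], where c = "-1"] Am sym bD(3)
    by (intro sum.cong) auto
  finally show ?thesis by (simp add: sum_negf)
qed

lemma trace_skew: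
  assumes A: "linear_on V V A"
    and skew: "\<And>x y. x \<in> V \<Longrightarrow> y \<in> V \<Longrightarrow> ip (A x) y = - ip x (A y)"
  shows "trace_on V A = 0"
proof -
  obtain b where b: "orthonormal_basis b" using orthonormal_basis_exists by blast
  then show ?thesis
    using sum_skew[OF b A skew bilinear ip_commute] trace_on_orthonormal_basis[OF A b] by simp
qed

lemma zero_if_zero_on_basis:
  assumes "orthonormal_basis b" and f: "linear_on V W f"
    and "\<And>x. x \<in> b \<Longrightarrow> f x = 0" and x: "x \<in> V"
  shows "f x = 0"
proof -
  note bD = orthonormal_basisD[OF assms(1)]
  have "f x = f (\<Sum>e\<in>b. ip x e *\<^sub>R e)" using bD(5)[OF x] by simp
  also have "\<dots> = (\<Sum>e\<in>b. f (ip x e *\<^sub>R e))"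
    using bD(3) by (intro linear_on_sum[OF f subspace]) auto
  also have "\<dots> = 0" using assms(3) bD(3) linear_on_scale[OF f] by (intro sum.neutral) auto
  finally show ?thesis .
qed

text \<open>
  Put \<open>E = S - S\<^sup>2 = [L, S]\<close>.  Since \<open>E\<close> is symmetric and commutes with \<open>S\<close>, one has
  \<open>tr(E\<^sup>2) = tr(L S E) - tr(S L E) = 0\<close>, and \<open>tr(E\<^sup>2)\<close> is the squared Hilbert-Schmidt norm of \<open>E\<close>.
\<close>

lemma idempotent_of_commutator:
  assumes L: "linear_on V V L" and S: "linear_on V V S"
    and sym: "\<And>x y. x \<in> V \<Longrightarrow> y \<in> V \<Longrightarrow> ip (S x) y = ip x (S y)"
    and comm: "\<And>x. x \<in> V \<Longrightarrow> L (S x) - S (L x) = S x - S (S x)"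
    and x: "x \<in> V"
  shows "S (S x) = S x"
proof -
  obtain b where b: "orthonormal_basis b" using orthonormal_basis_exists by blast
  note bD = orthonormal_basisD[OF b] and Lm = linear_on_mem[OF L] and Sm = linear_on_mem[OF S]
  note lin = linear_on_add[OF S] linear_on_scale[OF S] linear_on_diff[OF S subspace]
    linear_on_add[OF L] linear_on_scale[OF L]
  define E where "E x = S x - S (S x)" for x
  have Em: "E x \<in> V" if "x \<in> V" for x unfolding E_def using Sm that by auto
  have Elin: "linear_on V V E"
    unfolding linear_on_def using Em by (auto simp: E_def lin Sm algebra_simps)
  have SE: "S (E x) = E (S x)" if "x \<in> V" for x
    unfolding E_def using lin Sm that by simp
  have "(\<Sum>e\<in>b. ip (L (S e)) (E e)) = (\<Sum>e\<in>b. ip (L e) (E (S e)))"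
    by (rule sum_adjoint[OF b Sm Sm sym])
      (auto intro!: bilinear_onI simp: lin Lm Em linear_on_add[OF Elin] linear_on_scale[OF Elin])
  also have "\<dots> = (\<Sum>e\<in>b. ip (S (L e)) (E e))"
    using bD(3) Lm Em sym SE by (intro sum.cong) auto
  finally have "(\<Sum>e\<in>b. ip (L (S e)) (E e) - ip (S (L e)) (E e)) = 0"
    by (simp add: sum_subtractf)
  moreover have "ip (L (S e)) (E e) - ip (S (L e)) (E e) = ip (E e) (E e)" if "e \<in> b" for e
  proof -
    have "ip (L (S e)) (E e) - ip (S (L e)) (E e) = ip (L (S e) - S (L e)) (E e)"
      using bD(3)[OF that] Lm Em Sm by simp
    then show ?thesis using comm[of e] bD(3)[OF that] by (simp add: E_def)
  qed
  ultimately have "(\<Sum>e\<in>b. ip (E e) (E e)) = 0" by simp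
  then have "\<forall>e\<in>b. ip (E e) (E e) = 0"
    using bD(1,3) Em ip_nonneg by (subst (asm) sum_nonneg_eq_0_iff) auto
  then have "E e = 0" if "e \<in> b" for e
    using that Em bD(3) ip_eq_0_iff by auto
  then have "E x = 0" using zero_if_zero_on_basis[OF b Elin _ x] by blast
  then show ?thesis by (simp add: E_def)
qed

text \<open>
  \<open>A\<close> induces an operator \<open>a \<mapsto> A a(\<cdot>, \<cdot>) - a(A \<cdot>, \<cdot>) - a(\<cdot>, A \<cdot>)\<close> on the bilinear maps, and this operator
  is skew for the Hilbert-Schmidt product because \<open>A\<close> is skew.  So it has no real eigenvalue
  \<open>c\<close> other than zero.
\<close>

lemma skew_eigen_bilinear_zero:
  assumes A: "linear_on V V A"
    and skew: "\<And>x y. x \<in> V \<Longrightarrow> y \<in> V \<Longrightarrow> ip (A x) y = - ip x (A y)"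
    and a: "bilinear_on V V V a" and c: "c \<noteq> 0"
    and eig: "\<And>x y. x \<in> V \<Longrightarrow> y \<in> V \<Longrightarrow> A (a x y) = a (A x) y + a x (A y) + c *\<^sub>R a x y"
    and x: "x \<in> V" and y: "y \<in> V"
  shows "a x y = 0"
proof -
  obtain b where b: "orthonormal_basis b" using orthonormal_basis_exists by blast
  note bD = orthonormal_basisD[OF b] and Am = linear_on_mem[OF A]
  note al = bilinear_on_linear[OF a]
  note am = linear_on_mem[OF al(1)]
  have 1: "(\<Sum>i\<in>b. ip (a (A i) j) (a i j)) = 0" if j: "j \<in> V" for j
    by (rule sum_skew[OF b A skew])
      (auto intro!: bilinear_onI ip_commute
        simp: linear_on_add[OF al(2)] linear_on_scale[OF al(2)] am j)
  have 2: "(\<Sum>j\<in>b. ip (a i (A j)) (a i j)) = 0" if i: "i \<in> V" for i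
    by (rule sum_skew[OF b A skew])
      (auto intro!: bilinear_onI ip_commute
        simp: linear_on_add[OF al(1)] linear_on_scale[OF al(1)] am i)
  have 3: "c * ip (a i j) (a i j) = - ip (a (A i) j) (a i j) - ip (a i (A j)) (a i j)"
    if ij: "i \<in> b" "j \<in> b" for i j
  proof -
    have m: "i \<in> V" "j \<in> V" using ij bD(3) by auto
    have "ip (A (a i j)) (a i j) = 0"
      using skew[of "a i j" "a i j"] ip_commute[of "a i j" "A (a i j)"] am m Am by simp
    then show ?thesis using eig[OF m] am m Am by simp
  qed
  have "c * (\<Sum>i\<in>b. \<Sum>j\<in>b. ip (a i j) (a i j))
      = (\<Sum>i\<in>b. \<Sum>j\<in>b. - ip (a (A i) j) (a i j) - ip (a i (A j)) (a i j))"
    unfolding sum_distrib_left by (intro sum.cong refl 3)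
  also have "\<dots> = - (\<Sum>i\<in>b. \<Sum>j\<in>b. ip (a (A i) j) (a i j))
      - (\<Sum>i\<in>b. \<Sum>j\<in>b. ip (a i (A j)) (a i j))"
    by (simp add: sum_subtractf sum_negf)
  also have "(\<Sum>i\<in>b. \<Sum>j\<in>b. ip (a (A i) j) (a i j)) = (\<Sum>j\<in>b. \<Sum>i\<in>b. ip (a (A i) j) (a i j))"
    by (rule sum.swap)
  also have "- \<dots> - (\<Sum>i\<in>b. \<Sum>j\<in>b. ip (a i (A j)) (a i j)) = 0" using 1 2 bD(3) by simp
  finally have "(\<Sum>i\<in>b. \<Sum>j\<in>b. ip (a i j) (a i j)) = 0" using c by simp
  then have "\<forall>i\<in>b. (\<Sum>j\<in>b. ip (a i j) (a i j)) = 0"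
    using bD(1,3) am ip_nonneg by (subst (asm) sum_nonneg_eq_0_iff) (auto intro!: sum_nonneg)
  then have "\<forall>i\<in>b. \<forall>j\<in>b. ip (a i j) (a i j) = 0"
    using bD(1,3) am ip_nonneg by (simp add: sum_nonneg_eq_0_iff)
  then have z: "a i j = 0" if "i \<in> b" "j \<in> b" for i j
    using that bD(3) am ip_eq_0_iff by simp
  have "a i y = 0" if "i \<in> b" for i
    using zero_if_zero_on_basis[OF b al(1) z y] that bD(3) by blast
  then show ?thesis using zero_if_zero_on_basis[OF b al(2)[OF y] _ x] by blast
qed

end

lemma trace_on_isometry:
  assumes "euclidean_on V ip" "euclidean_on W ip'"
    and \<psi>: "linear_on V W \<psi>" and surj: "\<psi> ` V = W"
    and isom: "\<And>x y. x \<in> V \<Longrightarrow> y \<in> V \<Longrightarrow> ip' (\<psi> x) (\<psi> y) = ip x y"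
    and f: "linear_on V V f" and f': "linear_on W W f'"
    and comm: "\<And>x. x \<in> V \<Longrightarrow> \<psi> (f x) = f' (\<psi> x)"
  shows "trace_on V f = trace_on W f'"
proof -
  interpret V: euclidean_on V ip by fact
  interpret W: euclidean_on W ip' by fact
  obtain b where b: "V.orthonormal_basis b" using V.orthonormal_basis_exists by blast
  note bD = V.orthonormal_basisD[OF b]
  have inj: "inj_on \<psi> b"
  proof (rule inj_onI)
    fix e e' assume e: "e \<in> b" "e' \<in> b" "\<psi> e = \<psi> e'"
    then have "ip e e' = ip e e" using isom[of e e'] isom[of e e] bD(3) by simp
    then show "e = e'" using bD(4)[of e e'] bD(4)[of e e] e by (auto split: if_splits)
  qed
  have "W.orthonormal_basis (\<psi> ` b)"
    unfolding W.orthonormal_basis_def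
  proof (intro conjI ballI)
    show "finite (\<psi> ` b)" "\<psi> ` b \<subseteq> W" using bD(1,2) surj by auto
    fix e e' assume "e \<in> \<psi> ` b" "e' \<in> \<psi> ` b"
    then show "ip' e e' = (if e = e' then 1 else 0)"
      using isom bD(3,4) inj by (auto simp: inj_on_eq_iff)
  next
    fix w assume "w \<in> W"
    then obtain v where v: "v \<in> V" "w = \<psi> v" using surj by blast
    have "\<psi> v = \<psi> (\<Sum>e\<in>b. ip v e *\<^sub>R e)" using bD(5)[OF v(1)] by simp
    also have "\<dots> = (\<Sum>e\<in>b. \<psi> (ip v e *\<^sub>R e))"
      using bD(3) by (intro linear_on_sum[OF \<psi> V.subspace]) auto
    also have "\<dots> = (\<Sum>e\<in>b. ip' w (\<psi> e) *\<^sub>R \<psi> e)"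
      using bD(3) v isom linear_on_scale[OF \<psi>] by (intro sum.cong) auto
    also have "\<dots> = (\<Sum>e\<in>\<psi> ` b. ip' w e *\<^sub>R e)" using inj by (simp add: sum.reindex)
    finally show "w = (\<Sum>e\<in>\<psi> ` b. ip' w e *\<^sub>R e)" using v by simp
  qed
  then have "trace_on W f' = (\<Sum>e\<in>\<psi> ` b. ip' (f' e) e)" by (rule W.trace_on_orthonormal_basis[OF f'])
  also have "\<dots> = (\<Sum>e\<in>b. ip' (\<psi> (f e)) (\<psi> e))"
    using inj comm bD(3) by (simp add: sum.reindex)
  also have "\<dots> = (\<Sum>e\<in>b. ip (f e) e)"
    using isom bD(3) linear_on_mem[OF f] by (intro sum.cong) auto
  finally show ?thesis using V.trace_on_orthonormal_basis[OF f b] by simp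
qed

section \<open>Left symmetry of the triple product\<close>

text \<open>
  This is the map whose vanishing is left symmetry; unlike the equation itself, it can be
  expanded by linearity in each argument.
\<close>

definition lsym_defect :: "('v \<Rightarrow> 'v \<Rightarrow> 'v) \<Rightarrow> 'v \<Rightarrow> 'v \<Rightarrow> 'v \<Rightarrow> 'v::real_vector" where
  "lsym_defect m X Y Z = associator m X Y Z - associator m Y X Z"

lemma lsym_defect_swap: "lsym_defect m Y X Z = - lsym_defect m X Y Z"
  by (simp add: lsym_defect_def)

context lspk_predata
begin

sublocale E1: euclidean_on h1 ip1
  using h1 ip1 by unfold_locales

sublocale E2: euclidean_on h2 ip2
  using h2 ip2 by unfold_locales

lemmas B1_lin = linear_on_mem[OF B1] linear_on_add[OF B1] linear_on_scale[OF B1]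
lemmas B2_lin = linear_on_mem[OF B2] linear_on_add[OF B2] linear_on_scale[OF B2]

lemma \<rho>1_lin:
  "x \<in> h1 \<Longrightarrow> a \<in> h2 \<Longrightarrow> \<rho>1 x a \<in> h2"
  "x \<in> h1 \<Longrightarrow> a \<in> h2 \<Longrightarrow> b \<in> h2 \<Longrightarrow> \<rho>1 x (a + b) = \<rho>1 x a + \<rho>1 x b"
  "x \<in> h1 \<Longrightarrow> y \<in> h1 \<Longrightarrow> a \<in> h2 \<Longrightarrow> \<rho>1 (x + y) a = \<rho>1 x a + \<rho>1 y a"
  "x \<in> h1 \<Longrightarrow> a \<in> h2 \<Longrightarrow> \<rho>1 x (c *\<^sub>R a) = c *\<^sub>R \<rho>1 x a"
  "x \<in> h1 \<Longrightarrow> a \<in> h2 \<Longrightarrow> \<rho>1 (c *\<^sub>R x) a = c *\<^sub>R \<rho>1 x a"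
  using \<rho>1 by (auto simp: bilinear_on_def linear_on_def)

lemma \<rho>2_lin:
  "a \<in> h2 \<Longrightarrow> x \<in> h1 \<Longrightarrow> \<rho>2 a x \<in> h1"
  "a \<in> h2 \<Longrightarrow> x \<in> h1 \<Longrightarrow> y \<in> h1 \<Longrightarrow> \<rho>2 a (x + y) = \<rho>2 a x + \<rho>2 a y"
  "a \<in> h2 \<Longrightarrow> b \<in> h2 \<Longrightarrow> x \<in> h1 \<Longrightarrow> \<rho>2 (a + b) x = \<rho>2 a x + \<rho>2 b x"
  "a \<in> h2 \<Longrightarrow> x \<in> h1 \<Longrightarrow> \<rho>2 a (c *\<^sub>R x) = c *\<^sub>R \<rho>2 a x"
  "a \<in> h2 \<Longrightarrow> x \<in> h1 \<Longrightarrow> \<rho>2 (c *\<^sub>R a) x = c *\<^sub>R \<rho>2 a x"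
  using \<rho>2 by (auto simp: bilinear_on_def linear_on_def)

lemma m2_lin:
  "a \<in> h2 \<Longrightarrow> b \<in> h2 \<Longrightarrow> a \<circ>\<^sub>2 b \<in> h2"
  "a \<in> h2 \<Longrightarrow> b \<in> h2 \<Longrightarrow> c \<in> h2 \<Longrightarrow> a \<circ>\<^sub>2 (b + c) = a \<circ>\<^sub>2 b + a \<circ>\<^sub>2 c"
  "a \<in> h2 \<Longrightarrow> b \<in> h2 \<Longrightarrow> c \<in> h2 \<Longrightarrow> (a + b) \<circ>\<^sub>2 c = a \<circ>\<^sub>2 c + b \<circ>\<^sub>2 c"
  "a \<in> h2 \<Longrightarrow> b \<in> h2 \<Longrightarrow> a \<circ>\<^sub>2 (r *\<^sub>R b) = r *\<^sub>R (a \<circ>\<^sub>2 b)"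
  "a \<in> h2 \<Longrightarrow> b \<in> h2 \<Longrightarrow> (r *\<^sub>R a) \<circ>\<^sub>2 b = r *\<^sub>R (a \<circ>\<^sub>2 b)"
  using m2 by (auto simp: bilinear_on_def linear_on_def)

lemma \<omega>1_mem: "x \<in> h1 \<Longrightarrow> y \<in> h1 \<Longrightarrow> \<omega>1 x y \<in> h2"
  and \<omega>1_ip: "x \<in> h1 \<Longrightarrow> y \<in> h1 \<Longrightarrow> a \<in> h2 \<Longrightarrow> ip2 (\<omega>1 x y) a = ip1 (\<rho>2 a x) y + ip1 (\<rho>2 a y) x"
  using omega1 by auto

lemma \<omega>2_mem: "a \<in> h2 \<Longrightarrow> b \<in> h2 \<Longrightarrow> \<omega>2 a b \<in> h1"
  and \<omega>2_ip: "a \<in> h2 \<Longrightarrow> b \<in> h2 \<Longrightarrow> x \<in> h1 \<Longrightarrow> ip1 (\<omega>2 a b) x = ip2 (\<rho>1 x a) b + ip2 (\<rho>1 x b) a"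
  using omega2 by auto

lemma \<omega>1_commute: "x \<in> h1 \<Longrightarrow> y \<in> h1 \<Longrightarrow> \<omega>1 x y = \<omega>1 y x"
  by (rule E2.ip_eqI) (auto simp: \<omega>1_mem \<omega>1_ip)

lemma \<omega>2_commute: "a \<in> h2 \<Longrightarrow> b \<in> h2 \<Longrightarrow> \<omega>2 a b = \<omega>2 b a"
  by (rule E1.ip_eqI) (auto simp: \<omega>2_mem \<omega>2_ip)

lemma \<omega>1_right:
  assumes "x \<in> h1" "y \<in> h1"
  shows "z \<in> h1 \<Longrightarrow> \<omega>1 x (y + z) = \<omega>1 x y + \<omega>1 x z" "\<omega>1 x (c *\<^sub>R y) = c *\<^sub>R \<omega>1 x y"
  using assms by (auto intro!: E2.ip_eqI simp: \<omega>1_mem \<omega>1_ip \<rho>2_lin algebra_simps)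

lemma \<omega>2_right:
  assumes "a \<in> h2" "b \<in> h2"
  shows "c \<in> h2 \<Longrightarrow> \<omega>2 a (b + c) = \<omega>2 a b + \<omega>2 a c" "\<omega>2 a (r *\<^sub>R b) = r *\<^sub>R \<omega>2 a b"
  using assms by (auto intro!: E1.ip_eqI simp: \<omega>2_mem \<omega>2_ip \<rho>1_lin algebra_simps)

lemma \<omega>1_left:
  assumes "x \<in> h1" "y \<in> h1"
  shows "z \<in> h1 \<Longrightarrow> \<omega>1 (y + z) x = \<omega>1 y x + \<omega>1 z x" "\<omega>1 (c *\<^sub>R y) x = c *\<^sub>R \<omega>1 y x"
  using \<omega>1_right assms \<omega>1_commute by auto

lemma \<omega>2_left:
  assumes "a \<in> h2" "b \<in> h2"
  shows "c \<in> h2 \<Longrightarrow> \<omega>2 (b + c) a = \<omega>2 b a + \<omega>2 c a" "\<omega>2 (r *\<^sub>R b) a = r *\<^sub>R \<omega>2 b a"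
  using \<omega>2_right assms \<omega>2_commute by auto

lemma \<omega>2_bilinear: "bilinear_on h2 h2 h1 \<omega>2"
  by (rule bilinear_onI) (auto simp: \<omega>2_mem \<omega>2_left \<omega>2_right)

lemma diff_left:
  "a \<in> h2 \<Longrightarrow> b \<in> h2 \<Longrightarrow> x \<in> h1 \<Longrightarrow> \<rho>2 (a - b) x = \<rho>2 a x - \<rho>2 b x"
  "a \<in> h2 \<Longrightarrow> b \<in> h2 \<Longrightarrow> c \<in> h2 \<Longrightarrow> \<omega>2 (a - b) c = \<omega>2 a c - \<omega>2 b c"
  using linear_on_diff[OF bilinear_on_linear(2)[OF \<rho>2] E2.subspace]
    linear_on_diff[OF bilinear_on_linear(2)[OF \<omega>2_bilinear] E2.subspace] by auto

lemmas lin = B1_lin B2_lin \<rho>1_lin \<rho>2_lin m2_lin \<omega>1_mem \<omega>2_mem \<omega>1_right \<omega>2_right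
  \<omega>1_left \<omega>2_left zero_laws omega_zero

abbreviation G where "G \<equiv> lspk_carrier h1 h2"

lemma subspace_G: "subspace G"
  unfolding lspk_carrier_def using E1.subspace E2.subspace
  by (auto intro!: subspace_Times)

lemma lspk_mult_bilinear: "bilinear_on G G G lspk_mult"
  by (rule bilinear_onI)
    (auto simp: lspk_carrier_def lspk_prod_def lin algebra_simps add_divide_distrib)

text \<open>
  In the next five lemmas the digits and the letter \<open>H\<close> name the summands of \<open>G\<close> that contain the
  first two arguments of the defect; the third argument runs through all three summands.  The
  components are arranged such that each one is, up to sign, the difference of the two sides
  of one of the conditions on the data or of one of the two derivation rules for \<open>\<omega>1\<close> and \<open>\<omega>2\<close>
  below.  The components that vanish identically do so by symmetry, by the definition of \<open>\<omega>1\<close>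
  and \<open>\<omega>2\<close>, or by the skewness of \<open>B1\<close> and \<open>B2\<close>.
\<close>

lemma defect_1_1:
  assumes "x \<in> h1" "y \<in> h1" "z \<in> h1" "c \<in> h2"
  shows "lsym_defect lspk_mult (x, 0, 0) (y, 0, 0) (z, 0, 0)
      = (0, \<rho>1 y (\<omega>1 x z) - \<rho>1 x (\<omega>1 y z), 0)"
    and "lsym_defect lspk_mult (x, 0, 0) (y, 0, 0) (0, c, 0)
      = (0, \<rho>1 y (\<rho>1 x c) - \<rho>1 x (\<rho>1 y c), 0)"
    and "lsym_defect lspk_mult (x, 0, 0) (y, 0, 0) (0, 0, 1) = 0"
  using assms \<omega>1_commute[of x y] E1.ip_commute[of x y]
  by (simp_all add: lsym_defect_def associator_def lspk_prod_def lin zero_prod_def)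

lemma defect_2_2:
  assumes "a \<in> h2" "b \<in> h2" "z \<in> h1" "c \<in> h2"
  shows "lsym_defect lspk_mult (0, a, 0) (0, b, 0) (z, 0, 0)
      = (\<rho>2 (a \<circ>\<^sub>2 b - b \<circ>\<^sub>2 a) z - (\<rho>2 a (\<rho>2 b z) - \<rho>2 b (\<rho>2 a z)), 0, 0)"
    and "lsym_defect lspk_mult (0, a, 0) (0, b, 0) (0, c, 0)
      = (- (\<rho>2 a (\<omega>2 b c) - \<rho>2 b (\<omega>2 a c) + \<omega>2 a (b \<circ>\<^sub>2 c) - \<omega>2 b (a \<circ>\<^sub>2 c)
          - \<omega>2 (a \<circ>\<^sub>2 b - b \<circ>\<^sub>2 a) c),
         associator (\<circ>\<^sub>2) a b c - associator (\<circ>\<^sub>2) b a c - (ip2 b c *\<^sub>R a - ip2 a c *\<^sub>R b),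
         ip2 (a \<circ>\<^sub>2 b - b \<circ>\<^sub>2 a) c - (ip2 (b \<circ>\<^sub>2 c) a - ip2 (a \<circ>\<^sub>2 c) b))"
    and "lsym_defect lspk_mult (0, a, 0) (0, b, 0) (0, 0, 1) = 0"
  using assms \<omega>2_commute[of a b] E2.ip_commute[of a b] E2.ip_commute[of "b \<circ>\<^sub>2 c" a]
    E2.ip_commute[of "a \<circ>\<^sub>2 c" b]
  by (simp_all add: diff_left lsym_defect_def associator_def lspk_prod_def lin zero_prod_def algebra_simps)

lemma defect_1_2:
  assumes "x \<in> h1" "b \<in> h2" "z \<in> h1" "c \<in> h2"
  shows "lsym_defect lspk_mult (x, 0, 0) (0, b, 0) (z, 0, 0)
      = (\<rho>2 (\<rho>1 x b) z + \<omega>2 b (\<omega>1 x z),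
         b \<circ>\<^sub>2 \<omega>1 x z - (\<omega>1 (\<rho>2 b x) z + \<omega>1 x (\<rho>2 b z) - ip1 x z *\<^sub>R b), 0)"
    and "lsym_defect lspk_mult (x, 0, 0) (0, b, 0) (0, c, 0)
      = (\<omega>2 (\<rho>1 x b) c + \<omega>2 b (\<rho>1 x c),
         b \<circ>\<^sub>2 \<rho>1 x c + \<rho>1 x b \<circ>\<^sub>2 c - \<rho>1 (\<rho>2 b x) c - \<omega>1 x (\<omega>2 b c) - \<rho>1 x (b \<circ>\<^sub>2 c), 0)"
    and "lsym_defect lspk_mult (x, 0, 0) (0, b, 0) (0, 0, 1) = 0"
  using assms \<omega>1_ip[of x z b] E2.ip_commute[of "\<omega>1 x z" b] E1.ip_commute[of "\<rho>2 b z" x]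
    \<omega>2_ip[of b c x] E1.ip_commute[of "\<omega>2 b c" x] E2.ip_commute[of "\<rho>1 x c" b]
  by (simp_all add: lsym_defect_def associator_def lspk_prod_def lin zero_prod_def algebra_simps)

lemma defect_1_H:
  assumes "x \<in> h1" "z \<in> h1" "c \<in> h2"
  shows "lsym_defect lspk_mult (x, 0, 0) (0, 0, 1) (z, 0, 0)
      = (0, B2 (\<omega>1 x z) - \<omega>1 (B1 x) z - \<omega>1 x (B1 z), 0)"
    and "lsym_defect lspk_mult (x, 0, 0) (0, 0, 1) (0, c, 0)
      = (0, B2 (\<rho>1 x c) - \<rho>1 x (B2 c) - (\<rho>1 (B1 x) c + (1/2) *\<^sub>R \<rho>1 x c), 0)"
    and "lsym_defect lspk_mult (x, 0, 0) (0, 0, 1) (0, 0, 1) = 0"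
  using assms B1_skew[of x z] scaleR_half_double[of "\<omega>1 x z"]
  by (simp_all add: lsym_defect_def associator_def lspk_prod_def lin zero_prod_def algebra_simps)

lemma defect_2_H:
  assumes "a \<in> h2" "z \<in> h1" "c \<in> h2"
  shows "lsym_defect lspk_mult (0, a, 0) (0, 0, 1) (z, 0, 0)
      = (B1 (\<rho>2 a z) - \<rho>2 a (B1 z) - \<rho>2 (B2 a) z, 0, 0)"
    and "lsym_defect lspk_mult (0, a, 0) (0, 0, 1) (0, c, 0)
      = (B1 (\<omega>2 a c) - \<omega>2 (B2 a) c - \<omega>2 a (B2 c) - (1/2) *\<^sub>R \<omega>2 a c,
         B2 (a \<circ>\<^sub>2 c) - (B2 a \<circ>\<^sub>2 c + a \<circ>\<^sub>2 B2 c), 0)"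
    and "lsym_defect lspk_mult (0, a, 0) (0, 0, 1) (0, 0, 1) = 0"
  using assms B2_skew[of a c] scaleR_half_double[of "\<omega>2 a c"]
  by (simp_all add: lsym_defect_def associator_def lspk_prod_def lin zero_prod_def algebra_simps)

abbreviation generators :: "'a set \<Rightarrow> 'b set \<Rightarrow> ('a \<times> 'b \<times> real) set" where
  "generators S T \<equiv> (\<lambda>x. (x, 0, 0)) ` S \<union> (\<lambda>a. (0, a, 0)) ` T \<union> {(0, 0, 1)}"

lemma generator_eqI:
  assumes f: "linear_on G W f" and "\<And>x. x \<in> h1 \<Longrightarrow> f (x, 0, 0) = 0"
    and "\<And>a. a \<in> h2 \<Longrightarrow> f (0, a, 0) = 0" and "f (0, 0, 1) = 0" and u: "u \<in> G"
  shows "f u = 0"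
proof -
  obtain x a s where xas: "u = (x, a, s)" "x \<in> h1" "a \<in> h2"
    using u unfolding lspk_carrier_def by auto
  have gen: "(x, 0, 0) \<in> G" "(0, a, 0) \<in> G" "(0, 0, 1) \<in> G" "(0, 0, s) \<in> G" "(0, a, s) \<in> G"
    using xas unfolding lspk_carrier_def by auto
  have "f u = f ((x, 0, 0) + ((0, a, 0) + s *\<^sub>R (0, 0, 1)))" by (simp add: xas)
  also have "\<dots> = f (x, 0, 0) + (f (0, a, 0) + s *\<^sub>R f (0, 0, 1))"
    using gen linear_on_add[OF f gen(1), of "(0, a, s)"] linear_on_add[OF f gen(2), of "(0, 0, s)"]
      linear_on_scale[OF f gen(3), of s] by simp
  finally show ?thesis using assms xas by simp
qed

lemma lsym_defect_linear:
  assumes "X \<in> G" "Y \<in> G"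
  shows "linear_on G G (lsym_defect lspk_mult X Y)"
    and "linear_on G G (\<lambda>Z. lsym_defect lspk_mult X Z Y)"
    and "linear_on G G (\<lambda>Z. lsym_defect lspk_mult Z X Y)"
proof -
  note l = bilinear_on_linear[OF lspk_mult_bilinear]
  note lr = linear_on_mem[OF l(1)] linear_on_add[OF l(1)] linear_on_add[OF l(2)]
    linear_on_scale[OF l(1)] linear_on_scale[OF l(2)]
    linear_on_diff[OF l(1) subspace_G] linear_on_diff[OF l(2) subspace_G]
    subspace_add[OF subspace_G] subspace_diff[OF subspace_G] subspace_scale[OF subspace_G]
  show "linear_on G G (lsym_defect lspk_mult X Y)"
    and "linear_on G G (\<lambda>Z. lsym_defect lspk_mult X Z Y)"
    and "linear_on G G (\<lambda>Z. lsym_defect lspk_mult Z X Y)"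
    using assms unfolding linear_on_def lsym_defect_def associator_def
    by (auto simp: lr scaleR_diff_right)
qed

text \<open>
  Antisymmetry in the first two arguments leaves five of the nine types of pairs, because the
  pair \<open>H, H\<close> is trivial.
\<close>

lemma lsym_defect_zeroI:
  assumes h11: "\<And>x y Z. \<lbrakk>x \<in> h1; y \<in> h1; Z \<in> generators h1 h2\<rbrakk>
      \<Longrightarrow> lsym_defect lspk_mult (x, 0, 0) (y, 0, 0) Z = 0"
    and h22: "\<And>a b Z. \<lbrakk>a \<in> h2; b \<in> h2; Z \<in> generators h1 h2\<rbrakk>
      \<Longrightarrow> lsym_defect lspk_mult (0, a, 0) (0, b, 0) Z = 0"
    and h12: "\<And>x b Z. \<lbrakk>x \<in> h1; b \<in> h2; Z \<in> generators h1 h2\<rbrakk>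
      \<Longrightarrow> lsym_defect lspk_mult (x, 0, 0) (0, b, 0) Z = 0"
    and h1H: "\<And>x Z. \<lbrakk>x \<in> h1; Z \<in> generators h1 h2\<rbrakk>
      \<Longrightarrow> lsym_defect lspk_mult (x, 0, 0) (0, 0, 1) Z = 0"
    and h2H: "\<And>a Z. \<lbrakk>a \<in> h2; Z \<in> generators h1 h2\<rbrakk>
      \<Longrightarrow> lsym_defect lspk_mult (0, a, 0) (0, 0, 1) Z = 0"
    and XYZ: "X \<in> G" "Y \<in> G" "Z \<in> G"
  shows "lsym_defect lspk_mult X Y Z = 0"
proof -
  let ?gen = "generators h1 h2"
  have genG: "?gen \<subseteq> G" unfolding lspk_carrier_def by auto
  have swap: "lsym_defect lspk_mult Y X Z = 0" if "lsym_defect lspk_mult X Y Z = 0" for X Y Z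
    using that lsym_defect_swap[of lspk_mult X Y Z] by simp
  have hHH: "lsym_defect lspk_mult (0, 0, 1) (0, 0, 1) Z = 0" for Z
    by (simp add: lsym_defect_def)
  have gen: "lsym_defect lspk_mult X Y Z = 0" if "X \<in> ?gen" "Y \<in> ?gen" "Z \<in> ?gen" for X Y Z
    using that(1,2)
    by (elim UnE imageE singletonE)
      (use that(3) in \<open>blast intro: h11 h22 h12 h1H h2H hHH swap[OF h12] swap[OF h1H] swap[OF h2H]\<close>)+
  \<comment> \<open>Linearity frees the arguments from the generators one at a time, starting with the last.\<close>
  have 1: "lsym_defect lspk_mult X Y Z = 0" if "X \<in> ?gen" "Y \<in> ?gen" "Z \<in> G" for X Y Z
    using that genG by (intro generator_eqI[OF lsym_defect_linear(1) _ _ _ that(3)] gen) auto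
  have 2: "lsym_defect lspk_mult X Y Z = 0" if "X \<in> ?gen" "Y \<in> G" "Z \<in> G" for X Y Z
    using that genG by (intro generator_eqI[OF lsym_defect_linear(2) _ _ _ that(2)] 1) auto
  show ?thesis
    using XYZ by (intro generator_eqI[OF lsym_defect_linear(3) _ _ _ XYZ(1)] 2) auto
qed

section \<open>Traces of left multiplications\<close>

definition ipG :: "'a \<times> 'b \<times> real \<Rightarrow> 'a \<times> 'b \<times> real \<Rightarrow> real" where
  "ipG = (\<lambda>(x, a, s) (y, b, t). ip1 x y + ip2 a b + s * t)"

lemma fin_dim_G: "fin_dim_subspace G"
proof -
  obtain b1 b2 where b: "finite b1" "span b1 = h1" "finite b2" "span b2 = h2"
    using h1 h2 unfolding fin_dim_subspace_def by blast
  let ?b = "generators b1 b2"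
  have bG: "?b \<subseteq> G" using b span_superset[of b1] span_superset[of b2] unfolding lspk_carrier_def by auto
  have l1: "linear (\<lambda>x. (x, 0, 0) :: 'a \<times> 'b \<times> real)"
    and l2: "linear (\<lambda>a. (0, a, 0) :: 'a \<times> 'b \<times> real)" by (auto intro!: linearI)
  have "u \<in> span ?b" if uG: "u \<in> G" for u
  proof -
    obtain x a s where u: "u = (x, a, s)" "x \<in> span b1" "a \<in> span b2"
      using uG b unfolding lspk_carrier_def by auto
    have "(x, 0, 0) \<in> span ((\<lambda>x. (x, 0, 0) :: 'a \<times> 'b \<times> real) ` b1)"
      unfolding linear_span_image[OF l1] using u by auto
    then have 1: "(x, 0, 0) \<in> span ?b" by (rule subsetD[OF span_mono, rotated]) auto
    have "(0, a, 0) \<in> span ((\<lambda>a. (0, a, 0) :: 'a \<times> 'b \<times> real) ` b2)"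
      unfolding linear_span_image[OF l2] using u by auto
    then have 2: "(0, a, 0) \<in> span ?b" by (rule subsetD[OF span_mono, rotated]) auto
    have "s *\<^sub>R (0, 0, 1) \<in> span ?b" by (intro span_scale span_base) auto
    from span_add[OF 1 span_add[OF 2 this]] show ?thesis by (simp add: u)
  qed
  then have "span ?b = G" using span_minimal[OF bG subspace_G] by blast
  moreover have "finite ?b" using b(1,3) by simp
  ultimately show ?thesis unfolding fin_dim_subspace_def by (intro exI[of _ ?b] conjI)
qed

sublocale EG: euclidean_on G ipG
proof
  show "fin_dim_subspace G" by (rule fin_dim_G)
  have "0 < ipG u u" if uG: "u \<in> G" "u \<noteq> 0" for u
  proof -
    obtain x a s where u: "u = (x, a, s)" "x \<in> h1" "a \<in> h2"
      using uG unfolding lspk_carrier_def by auto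
    have ne: "x \<noteq> 0 \<or> a \<noteq> 0 \<or> s \<noteq> 0" using uG u by (auto simp: zero_prod_def)
    have nn: "0 \<le> ip1 x x" "0 \<le> ip2 a a" "0 \<le> s * s"
      using E1.ip_nonneg E2.ip_nonneg u by auto
    have pos: "x \<noteq> 0 \<Longrightarrow> 0 < ip1 x x" "a \<noteq> 0 \<Longrightarrow> 0 < ip2 a a" "s \<noteq> 0 \<Longrightarrow> 0 < s * s"
      using E1.ip_pos[OF u(2)] E2.ip_pos[OF u(3)] by (auto simp: zero_less_mult_iff)
    have "0 < ip1 x x + ip2 a a + s * s"
      using ne
    proof (elim disjE)
      assume "x \<noteq> 0" then show ?thesis using pos(1) nn by linarith
    next
      assume "a \<noteq> 0" then show ?thesis using pos(2) nn by linarith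
    next
      assume "s \<noteq> 0" then show ?thesis using pos(3) nn by linarith
    qed
    then show ?thesis by (simp add: u ipG_def)
  qed
  moreover have "bilinear_on G G UNIV ipG"
    by (rule bilinear_onI) (auto simp: ipG_def lspk_carrier_def algebra_simps)
  moreover have "ipG u v = ipG v u" if "u \<in> G" "v \<in> G" for u v
    using that E1.ip_commute E2.ip_commute by (auto simp: ipG_def lspk_carrier_def mult.commute)
  ultimately show "scalar_product_on G ipG"
    unfolding scalar_product_on_def by blast
qed

lemma sum_orthonormal_G:
  assumes b1: "E1.orthonormal_basis b1" and b2: "E2.orthonormal_basis b2"
  shows "(\<Sum>e\<in>generators b1 b2. f e)
    = (\<Sum>e\<in>b1. f (e, 0, 0)) + (\<Sum>e\<in>b2. f (0, e, 0)) + (f (0, 0, 1 :: real) :: 'c::real_vector)"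
proof -
  have n: "0 \<notin> b1" "0 \<notin> b2"
    using E1.orthonormal_basisD(4)[OF b1, of 0 0] E2.orthonormal_basisD(4)[OF b2, of 0 0] by auto
  note fin = E1.orthonormal_basisD(1)[OF b1] E2.orthonormal_basisD(1)[OF b2]
  have "sum f (generators b1 b2)
      = sum f ((\<lambda>x. (x, 0, 0)) ` b1 \<union> (\<lambda>a. (0, a, 0)) ` b2) + sum f {(0, 0, 1)}"
    using fin by (intro sum.union_disjoint) auto
  also have "sum f ((\<lambda>x. (x, 0, 0)) ` b1 \<union> (\<lambda>a. (0, a, 0)) ` b2)
      = sum f ((\<lambda>x. (x, 0, 0)) ` b1) + sum f ((\<lambda>a. (0, a, 0)) ` b2)"
    using fin n by (intro sum.union_disjoint) auto
  also have "sum f ((\<lambda>x. (x, 0, 0)) ` b1) = (\<Sum>e\<in>b1. f (e, 0, 0))"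
    by (subst sum.reindex) (auto simp: inj_on_def)
  also have "sum f ((\<lambda>a. (0, a, 0)) ` b2) = (\<Sum>e\<in>b2. f (0, e, 0))"
    by (subst sum.reindex) (auto simp: inj_on_def)
  finally show ?thesis by simp
qed

lemma orthonormal_basis_G:
  assumes b1: "E1.orthonormal_basis b1" and b2: "E2.orthonormal_basis b2"
  shows "EG.orthonormal_basis (generators b1 b2)"
  unfolding EG.orthonormal_basis_def
proof (intro conjI ballI)
  note b1D = E1.orthonormal_basisD[OF b1] and b2D = E2.orthonormal_basisD[OF b2]
  have n: "0 \<notin> b1" "0 \<notin> b2" using b1D(4)[of 0 0] b2D(4)[of 0 0] by auto
  let ?b = "generators b1 b2"
  show "finite ?b" using b1D(1) b2D(1) by simp
  show "?b \<subseteq> G" using b1D(2) b2D(2) by (auto simp: lspk_carrier_def)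
  fix e e' assume "e \<in> ?b" "e' \<in> ?b"
  then show "ipG e e' = (if e = e' then 1 else 0)"
    using n b1D(3,4) b2D(3,4) by (auto simp: ipG_def split: if_splits)
next
  fix u assume "u \<in> G"
  then obtain x a s where u: "u = (x, a, s)" "x \<in> h1" "a \<in> h2"
    unfolding lspk_carrier_def by auto
  note b1D = E1.orthonormal_basisD[OF b1] and b2D = E2.orthonormal_basisD[OF b2]
  have "(\<Sum>e\<in>b1. ip1 x e *\<^sub>R (e, 0, 0)) = (x, 0 :: 'b, 0 :: real)"
    using b1D(5)[OF u(2)] by (intro prod_eqI) (auto simp: fst_sum snd_sum)
  moreover have "(\<Sum>e\<in>b2. ip2 a e *\<^sub>R (0, e, 0)) = (0 :: 'a, a, 0 :: real)"
    using b2D(5)[OF u(3)] by (intro prod_eqI) (auto simp: fst_sum snd_sum)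
  moreover have "(\<Sum>e\<in>b1. ipG u (e, 0, 0) *\<^sub>R (e, 0, 0)) = (\<Sum>e\<in>b1. ip1 x e *\<^sub>R (e, 0 :: 'b, 0 :: real))"
    using b1D(3) u by (intro sum.cong) (auto simp: ipG_def)
  moreover have "(\<Sum>e\<in>b2. ipG u (0, e, 0) *\<^sub>R (0, e, 0)) = (\<Sum>e\<in>b2. ip2 a e *\<^sub>R (0 :: 'a, e, 0 :: real))"
    using b2D(3) u by (intro sum.cong) (auto simp: ipG_def)
  ultimately show "u = (\<Sum>e\<in>generators b1 b2. ipG u e *\<^sub>R e)"
    unfolding sum_orthonormal_G[OF b1 b2] using u by (simp add: ipG_def)
qed

text \<open>
  Only the diagonal blocks of \<open>L\<^bsub>(x, a, s)\<^esub>\<close> count: \<open>\<rho>2 a + s (B1 + 1/2)\<close> on \<open>h1\<close>,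
  \<open>\<rho>1 x + L\<^sub>a + s (B2 + 1)\<close> on \<open>h2\<close> and \<open>s\<close> on \<open>\<real>H\<close>, and the skew maps have trace zero.
\<close>

lemma trace_lspk_mult:
  assumes "x \<in> h1" "a \<in> h2"
  shows "trace_on G (lspk_mult (x, a, s))
    = trace_on h2 (\<rho>1 x) + (trace_on h2 (\<lambda>b. a \<circ>\<^sub>2 b) + trace_on h1 (\<rho>2 a))
      + s * (1/2 * real (dim h1) + real (dim h2) + 1)"
proof -
  obtain b1 where b1: "E1.orthonormal_basis b1" using E1.orthonormal_basis_exists by blast
  obtain b2 where b2: "E2.orthonormal_basis b2" using E2.orthonormal_basis_exists by blast
  note b1D = E1.orthonormal_basisD[OF b1] and b2D = E2.orthonormal_basisD[OF b2]
  have skew1: "(\<Sum>e\<in>b1. ip1 (B1 e) e) = 0"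
    using E1.trace_skew[OF B1 B1_skew] E1.trace_on_orthonormal_basis[OF B1 b1] by simp
  have skew2: "(\<Sum>e\<in>b2. ip2 (B2 e) e) = 0"
    using E2.trace_skew[OF B2 B2_skew] E2.trace_on_orthonormal_basis[OF B2 b2] by simp
  have "(x, a, s) \<in> G" using assms by (simp add: lspk_carrier_def)
  then have "trace_on G (lspk_mult (x, a, s))
      = (\<Sum>e\<in>b1. ipG ((x, a, s) \<bullet>\<^sub>g (e, 0, 0)) (e, 0, 0))
        + (\<Sum>e\<in>b2. ipG ((x, a, s) \<bullet>\<^sub>g (0, e, 0)) (0, e, 0))
        + ipG ((x, a, s) \<bullet>\<^sub>g (0, 0, 1)) (0, 0, 1)"
    using EG.trace_on_orthonormal_basis[OF bilinear_on_linear(1)[OF lspk_mult_bilinear]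
        orthonormal_basis_G[OF b1 b2]] sum_orthonormal_G[OF b1 b2] by simp
  also have "(\<Sum>e\<in>b1. ipG ((x, a, s) \<bullet>\<^sub>g (e, 0, 0)) (e, 0, 0))
      = (\<Sum>e\<in>b1. ip1 (\<rho>2 a e) e + s * ip1 (B1 e) e + s * (1/2))"
    using assms b1D(3,4) by (intro sum.cong) (auto simp: ipG_def lspk_prod_def lin algebra_simps)
  also have "\<dots> = trace_on h1 (\<rho>2 a) + s * (1/2 * real (dim h1))"
    using skew1 E1.trace_on_orthonormal_basis[OF bilinear_on_linear(1)[OF \<rho>2] b1] assms
      E1.card_orthonormal_basis[OF b1]
    by (simp add: sum.distrib sum_distrib_left[symmetric])
  also have "(\<Sum>e\<in>b2. ipG ((x, a, s) \<bullet>\<^sub>g (0, e, 0)) (0, e, 0))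
      = (\<Sum>e\<in>b2. ip2 (\<rho>1 x e) e + ip2 (a \<circ>\<^sub>2 e) e + s * ip2 (B2 e) e + s)"
    using assms b2D(3,4) by (intro sum.cong) (auto simp: ipG_def lspk_prod_def lin algebra_simps)
  also have "\<dots> = trace_on h2 (\<rho>1 x) + trace_on h2 (\<lambda>b. a \<circ>\<^sub>2 b) + s * real (dim h2)"
    using skew2 E2.trace_on_orthonormal_basis[OF bilinear_on_linear(1)[OF \<rho>1] b2]
      E2.trace_on_orthonormal_basis[OF bilinear_on_linear(1)[OF m2] b2] assms
      E2.card_orthonormal_basis[OF b2]
    by (simp add: sum.distrib sum_distrib_left[symmetric])
  also have "ipG ((x, a, s) \<bullet>\<^sub>g (0, 0, 1)) (0, 0, 1) = s"
    using assms by (simp add: ipG_def lspk_prod_def lin)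
  finally show ?thesis by (simp add: algebra_simps)
qed

section \<open>The conditions on the data as left symmetry and a trace formula\<close>

text \<open>
  The two rules that the defects with second argument \<open>H\<close> require beyond the conditions on the data:
  pairing with a vector of \<open>h2\<close>, respectively \<open>h1\<close>, and moving the skew maps across the scalar
  products turns them into those for \<open>[B1, \<rho>2 a]\<close> and \<open>[B2, \<rho>1 x]\<close>.
\<close>

lemma \<omega>1_derivation:
  assumes "\<And>a y. a \<in> h2 \<Longrightarrow> y \<in> h1 \<Longrightarrow> B1 (\<rho>2 a y) - \<rho>2 a (B1 y) = \<rho>2 (B2 a) y"
    and "x \<in> h1" "z \<in> h1"
  shows "B2 (\<omega>1 x z) = \<omega>1 (B1 x) z + \<omega>1 x (B1 z)"
proof (rule E2.ip_eqI)
  fix a assume a: "a \<in> h2"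
  have 1: "\<rho>2 (B2 a) y = B1 (\<rho>2 a y) - \<rho>2 a (B1 y)" if "y \<in> h1" for y
    using assms(1)[OF a that] by simp
  show "ip2 (B2 (\<omega>1 x z)) a = ip2 (\<omega>1 (B1 x) z + \<omega>1 x (B1 z)) a"
    using assms(2,3) a
    by (simp add: B2_skew \<omega>1_ip lin 1 B1_skew)
qed (use assms in \<open>auto simp: lin\<close>)

lemma \<omega>2_derivation:
  assumes "\<And>x c. x \<in> h1 \<Longrightarrow> c \<in> h2 \<Longrightarrow> B2 (\<rho>1 x c) - \<rho>1 x (B2 c) = \<rho>1 (B1 x) c + (1/2) *\<^sub>R \<rho>1 x c"
    and "a \<in> h2" "c \<in> h2"
  shows "B1 (\<omega>2 a c) = \<omega>2 (B2 a) c + \<omega>2 a (B2 c) + (1/2) *\<^sub>R \<omega>2 a c"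
proof (rule E1.ip_eqI)
  fix x assume x: "x \<in> h1"
  have 1: "\<rho>1 (B1 x) c = B2 (\<rho>1 x c) - \<rho>1 x (B2 c) - (1/2) *\<^sub>R \<rho>1 x c" if "c \<in> h2" for c
    using assms(1)[OF x that] by (simp add: algebra_simps)
  show "ip1 (B1 (\<omega>2 a c)) x = ip1 (\<omega>2 (B2 a) c + \<omega>2 a (B2 c) + (1/2) *\<^sub>R \<omega>2 a c) x"
    using assms(2,3) x
    by (simp add: B1_skew \<omega>2_ip lin 1 B2_skew algebra_simps)
qed (use assms in \<open>auto simp: lin\<close>)

lemma trace_zero_laws:
  "trace_on h2 (\<rho>1 0) = 0" "trace_on h1 (\<rho>2 0) = 0" "trace_on h2 (\<lambda>b. 0 \<circ>\<^sub>2 b) = 0"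
proof -
  note z = zero_laws(1,2)
  obtain b1 where b1: "E1.orthonormal_basis b1" using E1.orthonormal_basis_exists by blast
  obtain b2 where b2: "E2.orthonormal_basis b2" using E2.orthonormal_basis_exists by blast
  have "linear_on h2 h2 (\<rho>1 0)" "linear_on h2 h2 (\<lambda>b. 0 \<circ>\<^sub>2 b)" "linear_on h1 h1 (\<rho>2 0)"
    using bilinear_on_linear(1)[OF \<rho>1 z(1)] bilinear_on_linear(1)[OF m2 z(2)]
      bilinear_on_linear(1)[OF \<rho>2 z(2)] by auto
  then show "trace_on h2 (\<rho>1 0) = 0" "trace_on h1 (\<rho>2 0) = 0" "trace_on h2 (\<lambda>b. 0 \<circ>\<^sub>2 b) = 0"
    using E1.orthonormal_basisD(3)[OF b1] E2.orthonormal_basisD(3)[OF b2] b1 b2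
    by (simp_all add: E1.trace_on_orthonormal_basis[OF _ b1] E2.trace_on_orthonormal_basis[OF _ b2] lin)
qed

lemma trace_lspk_mult_H:
  "trace_on G (lspk_mult (0, 0, 1)) = 1/2 * real (dim h1) + real (dim h2) + 1"
  using trace_lspk_mult[OF zero_laws(1,2), of 1] by (simp add: trace_zero_laws)

text \<open>
  The defect lemmas translate left symmetry into the conditions.  The trace formula is linear in
  \<open>(x, a, s)\<close>: on \<open>h1\<close> it is \<open>tr (\<rho>1 x) = 0\<close>, on \<open>h2\<close> it is \<open>tr L\<^sub>a = - tr (\<rho>2 a)\<close>, and at \<open>H\<close> it always
  holds.
\<close>

theorem lspk_data_iff:
  "lspk_data h1 ip1 h2 m2 ip2 B1 B2 \<rho>1 \<rho>2 \<longleftrightarrow>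
    (\<forall>X\<in>G. \<forall>Y\<in>G. \<forall>Z\<in>G. lsym_defect lspk_mult X Y Z = 0) \<and>
    (\<forall>x\<in>h1. \<forall>a\<in>h2. \<forall>s. trace_on G (lspk_mult (x, a, s))
      = s * (1/2 * real (dim h1) + real (dim h2) + 1))" (is "_ \<longleftrightarrow> ?lsym \<and> ?tr")
proof
  assume "lspk_data h1 ip1 h2 m2 ip2 B1 B2 \<rho>1 \<rho>2"
  then interpret lspk_data h1 ip1 h2 m2 ip2 B1 B2 \<rho>1 \<rho>2 .
  have ?tr by (simp add: trace_lspk_mult tr_\<rho>1 S2_5)
  have d11: "lsym_defect lspk_mult (x, 0, 0) (y, 0, 0) (z, 0, 0) = 0"
      "lsym_defect lspk_mult (x, 0, 0) (y, 0, 0) (0, c, 0) = 0"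
    if "x \<in> h1" "y \<in> h1" "z \<in> h1" "c \<in> h2" for x y z c
    using that S3_3[of x y z] \<rho>1_comm[of x y c] by (simp_all add: defect_1_1 zero_prod_def)
  have d22: "lsym_defect lspk_mult (0, a, 0) (0, b, 0) (z, 0, 0) = 0"
      "lsym_defect lspk_mult (0, a, 0) (0, b, 0) (0, c, 0) = 0"
    if "a \<in> h2" "b \<in> h2" "z \<in> h1" "c \<in> h2" for a b z c
    unfolding defect_2_2[OF that]
    using that S3_4[of a b c] \<rho>2_rep[of a b z] S2_2[of a b c] S2_1[of a b c]
    by (simp_all del: E2.ip_left add: zero_prod_def)
  have d12: "lsym_defect lspk_mult (x, 0, 0) (0, b, 0) (z, 0, 0) = 0"
      "lsym_defect lspk_mult (x, 0, 0) (0, b, 0) (0, c, 0) = 0"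
    if "x \<in> h1" "b \<in> h2" "z \<in> h1" "c \<in> h2" for x b z c
    unfolding defect_1_2[OF that]
    using that S3_2[of b x z] S3_6[of b x z] S3_5[of x b c] S3_1[of x b c]
    by (simp_all add: zero_prod_def)
  have d1H: "lsym_defect lspk_mult (x, 0, 0) (0, 0, 1) (z, 0, 0) = 0"
      "lsym_defect lspk_mult (x, 0, 0) (0, 0, 1) (0, c, 0) = 0"
    if "x \<in> h1" "z \<in> h1" "c \<in> h2" for x z c
    unfolding defect_1_H[OF that]
    using that \<omega>1_derivation[OF S3_8, of x z] S3_7[of x c]
    by (simp_all add: zero_prod_def)
  have d2H: "lsym_defect lspk_mult (0, a, 0) (0, 0, 1) (z, 0, 0) = 0"
      "lsym_defect lspk_mult (0, a, 0) (0, 0, 1) (0, c, 0) = 0"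
    if "a \<in> h2" "z \<in> h1" "c \<in> h2" for a z c
    unfolding defect_2_H[OF that]
    using that \<omega>2_derivation[OF S3_7, of a c] S3_8[of a z] S2_3[of a c]
    by (simp_all add: zero_prod_def)
  have gen: "lsym_defect lspk_mult (x, 0, 0) (y, 0, 0) Z = 0"
      "lsym_defect lspk_mult (0, a, 0) (0, b, 0) Z = 0"
      "lsym_defect lspk_mult (x, 0, 0) (0, b, 0) Z = 0"
      "lsym_defect lspk_mult (x, 0, 0) (0, 0, 1) Z = 0"
      "lsym_defect lspk_mult (0, a, 0) (0, 0, 1) Z = 0"
    if m: "x \<in> h1" "y \<in> h1" "a \<in> h2" "b \<in> h2" and Z: "Z \<in> generators h1 h2" for x y a b Z
  proof -
    consider (1) z where "Z = (z, 0, 0)" "z \<in> h1" | (2) c where "Z = (0, c, 0)" "c \<in> h2"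
      | (H) "Z = (0, 0, 1)"
      using Z by (elim UnE imageE singletonE) simp_all
    note Z = this
    note H = defect_1_1(3) defect_2_2(3) defect_1_2(3) defect_1_H(3) defect_2_H(3)
    show "lsym_defect lspk_mult (x, 0, 0) (y, 0, 0) Z = 0"
      using m d11 H(1) zero_laws(1,2) by (cases rule: Z) metis+
    show "lsym_defect lspk_mult (0, a, 0) (0, b, 0) Z = 0"
      using m d22 H(2) zero_laws(1,2) by (cases rule: Z) metis+
    show "lsym_defect lspk_mult (x, 0, 0) (0, b, 0) Z = 0"
      using m d12 H(3) zero_laws(1,2) by (cases rule: Z) metis+
    show "lsym_defect lspk_mult (x, 0, 0) (0, 0, 1) Z = 0"
      using m d1H H(4) zero_laws(1,2) by (cases rule: Z) metis+
    show "lsym_defect lspk_mult (0, a, 0) (0, 0, 1) Z = 0"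
      using m d2H H(5) zero_laws(1,2) by (cases rule: Z) metis+
  qed
  have ?lsym
    by (intro ballI, rule lsym_defect_zeroI) (assumption | rule gen zero_laws(1,2))+
  with \<open>?tr\<close> show "?lsym \<and> ?tr" by blast
next
  assume "?lsym \<and> ?tr"
  then have lsym: ?lsym and tr: ?tr by blast+
  have D: "lsym_defect lspk_mult X Y Z = 0" if "X \<in> G" "Y \<in> G" "Z \<in> G" for X Y Z
    using lsym that by blast
  have g: "x \<in> h1 \<Longrightarrow> (x, 0, 0) \<in> G" "a \<in> h2 \<Longrightarrow> (0, a, 0) \<in> G" "(0, 0, 1) \<in> G" for x a
    using zero_laws(1,2) by (auto simp: lspk_carrier_def)
  note z = zero_laws(1,2)
  have d11: "\<rho>1 y (\<omega>1 x z) - \<rho>1 x (\<omega>1 y z) = 0" "\<rho>1 y (\<rho>1 x c) - \<rho>1 x (\<rho>1 y c) = 0"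
    if "x \<in> h1" "y \<in> h1" "z \<in> h1" "c \<in> h2" for x y z c
    using defect_1_1[OF that] D[of "(x, 0, 0)" "(y, 0, 0)" "(z, 0, 0)", OF g(1) g(1) g(1)] D[of "(x, 0, 0)" "(y, 0, 0)" "(0, c, 0)", OF g(1) g(1) g(2)] that
    by (simp_all add: zero_prod_def)
  have tr1: "trace_on h2 (\<rho>1 x) = 0" if "x \<in> h1" for x
    using tr that z trace_lspk_mult[of x 0 0] by (simp add: trace_zero_laws)
  have tr2: "trace_on h2 (\<lambda>b. a \<circ>\<^sub>2 b) = - trace_on h1 (\<rho>2 a)" if "a \<in> h2" for a
    using tr that z trace_lspk_mult[of 0 a 0] tr1[OF z(1)] by simp
  have d22: "\<rho>2 (a \<circ>\<^sub>2 b - b \<circ>\<^sub>2 a) z = \<rho>2 a (\<rho>2 b z) - \<rho>2 b (\<rho>2 a z)"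
      "\<rho>2 a (\<omega>2 b c) - \<rho>2 b (\<omega>2 a c) + \<omega>2 a (b \<circ>\<^sub>2 c) - \<omega>2 b (a \<circ>\<^sub>2 c)
        - \<omega>2 (a \<circ>\<^sub>2 b - b \<circ>\<^sub>2 a) c = 0"
      "associator (\<circ>\<^sub>2) a b c - associator (\<circ>\<^sub>2) b a c = ip2 b c *\<^sub>R a - ip2 a c *\<^sub>R b"
      "ip2 (a \<circ>\<^sub>2 b - b \<circ>\<^sub>2 a) c = ip2 (b \<circ>\<^sub>2 c) a - ip2 (a \<circ>\<^sub>2 c) b"
    if "a \<in> h2" "b \<in> h2" "z \<in> h1" "c \<in> h2" for a b z c
    using D[of "(0, a, 0)" "(0, b, 0)" "(z, 0, 0)", OF g(2) g(2) g(1)] D[of "(0, a, 0)" "(0, b, 0)" "(0, c, 0)", OF g(2) g(2) g(2)] z that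
    unfolding defect_2_2[OF that] zero_prod_def prod.inject neg_equal_0_iff_equal
    by (blast intro: eq_iff_diff_eq_0[THEN iffD2])+
  have d12: "\<rho>2 (\<rho>1 x b) z + \<omega>2 b (\<omega>1 x z) = 0"
      "b \<circ>\<^sub>2 \<omega>1 x z = \<omega>1 (\<rho>2 b x) z + \<omega>1 x (\<rho>2 b z) - ip1 x z *\<^sub>R b"
      "\<omega>2 (\<rho>1 x b) c + \<omega>2 b (\<rho>1 x c) = 0"
      "\<rho>1 x (b \<circ>\<^sub>2 c) = b \<circ>\<^sub>2 \<rho>1 x c + \<rho>1 x b \<circ>\<^sub>2 c - \<rho>1 (\<rho>2 b x) c - \<omega>1 x (\<omega>2 b c)"
    if "x \<in> h1" "b \<in> h2" "z \<in> h1" "c \<in> h2" for x b z c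
    using D[of "(x, 0, 0)" "(0, b, 0)" "(z, 0, 0)", OF g(1) g(2) g(1)] D[of "(x, 0, 0)" "(0, b, 0)" "(0, c, 0)", OF g(1) g(2) g(2)] z that
    unfolding defect_1_2[OF that] zero_prod_def prod.inject
    by (blast intro: eq_iff_diff_eq_0[THEN iffD2] eq_iff_diff_eq_0[THEN iffD2, symmetric])+
  have d1H: "B2 (\<rho>1 x c) - \<rho>1 x (B2 c) = \<rho>1 (B1 x) c + (1/2) *\<^sub>R \<rho>1 x c"
    if "x \<in> h1" "c \<in> h2" for x c
    using D[of "(x, 0, 0)" "(0, 0, 1)" "(0, c, 0)", OF g(1) g(3) g(2)] z that
    unfolding defect_1_H(2)[OF that(1) z(1) that(2)] zero_prod_def prod.inject
    by (blast intro: eq_iff_diff_eq_0[THEN iffD2])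
  have d2H: "B1 (\<rho>2 a z) - \<rho>2 a (B1 z) = \<rho>2 (B2 a) z" if "a \<in> h2" "z \<in> h1" for a z
    using D[of "(0, a, 0)" "(0, 0, 1)" "(z, 0, 0)", OF g(2) g(3) g(1)] zero_laws(1,2) that
    unfolding defect_2_H(1)[OF that zero_laws(2)] zero_prod_def prod.inject
    by (blast intro: eq_iff_diff_eq_0[THEN iffD2])
  have d2H': "B2 (a \<circ>\<^sub>2 c) = B2 a \<circ>\<^sub>2 c + a \<circ>\<^sub>2 B2 c" if "a \<in> h2" "c \<in> h2" for a c
    using D[of "(0, a, 0)" "(0, 0, 1)" "(0, c, 0)", OF g(2) g(3) g(2)] z that
    unfolding defect_2_H(2)[OF that(1) z(1) that(2)] zero_prod_def prod.inject
    by (blast intro: eq_iff_diff_eq_0[THEN iffD2])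
  have B2s: "ip2 (B2 a) c = - ip2 (B2 c) a" if "a \<in> h2" "c \<in> h2" for a c
    using B2_skew[OF that] E2.ip_commute[of a "B2 c"] that by (simp add: lin)
  show "lspk_data h1 ip1 h2 m2 ip2 B1 B2 \<rho>1 \<rho>2"
    by unfold_locales
      (fact tr1 tr2 B2s d2H d2H' d1H d11(2)[OF _ _ z(1)] d11(1)[OF _ _ _ z(2)]
        d22(1)[OF _ _ _ z(2)] d22(2-4)[OF _ _ z(1)] d12(1,2)[OF _ _ _ z(2)] d12(3,4)[OF _ _ z(1)]
       | (rule d12(1,2)[OF _ _ _ z(2)] d12(3,4)[OF _ _ z(1)] d22(2-4)[OF _ _ z(1)]
            d11(2)[OF _ _ z(1)] d11(1)[OF _ _ _ z(2)]; assumption))+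
qed

end

context lspk_data
begin

text \<open>
  The last component of \<open>u \<bullet> v\<close> is \<open>ipG u v\<close>, and the trace of a left multiplication sees only that
  component.
\<close>

lemma koszul_form_lspk_mult:
  assumes "u \<in> G" "v \<in> G"
  shows "koszul_form G lspk_mult u v = (1/2 * real (dim h1) + real (dim h2) + 1) * ipG u v"
proof -
  obtain x a s y b t where u: "u = (x, a, s)" "x \<in> h1" "a \<in> h2"
    and v: "v = (y, b, t)" "y \<in> h1" "b \<in> h2"
    using assms unfolding lspk_carrier_def by auto
  obtain z c where "u \<bullet>\<^sub>g v = (z, c, ipG u v)" "z \<in> h1" "c \<in> h2"
    using u v by (auto simp: lspk_prod_def ipG_def lin)
  moreover have "trace_on G (lspk_mult (z, c, k)) = k * (1/2 * real (dim h1) + real (dim h2) + 1)"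
    if "z \<in> h1" "c \<in> h2" for z c k
    using that lspk_data_axioms lspk_data_iff by blast
  ultimately show ?thesis
    unfolding koszul_form_def by (simp add: mult.commute)
qed

theorem LSPK_lspk_mult: "LSPK G lspk_mult"
proof -
  let ?\<rho> = "1/2 * real (dim h1) + real (dim h2) + 1"
  have pos: "0 < ?\<rho>" by (simp add: add_nonneg_pos)
  have "lsym_defect lspk_mult X Y Z = 0" if "X \<in> G" "Y \<in> G" "Z \<in> G" for X Y Z
    using that lspk_data_axioms lspk_data_iff by blast
  then have "left_symmetric_algebra G lspk_mult"
    using fin_dim_G lspk_mult_bilinear
    by (simp add: left_symmetric_algebra_def lsym_defect_def)
  moreover have "(0, 0, 1) \<in> G" using zero_laws(1,2) by (simp add: lspk_carrier_def)
  then have "G \<noteq> {0}" by (auto simp: zero_prod_def)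
  moreover have "scalar_product_on G (koszul_form G lspk_mult)"
    unfolding scalar_product_on_def
  proof (intro conjI ballI impI)
    show "bilinear_on G G UNIV (koszul_form G lspk_mult)"
      by (rule bilinear_onI) (simp_all add: koszul_form_lspk_mult algebra_simps)
  qed (use EG.ip_commute EG.ip_pos pos in \<open>simp_all add: koszul_form_lspk_mult\<close>)
  ultimately show ?thesis unfolding LSPK_def by blast
qed

end

section \<open>The Peirce decomposition of an LSPK\<close>

locale lspk =
  fixes g :: "'g::real_vector set" and m :: "'g \<Rightarrow> 'g \<Rightarrow> 'g" (infixl \<open>\<star>\<close> 70)
  assumes LSPK: "LSPK g m"
begin

abbreviation B where "B \<equiv> koszul_form g m"

sublocale euclidean_on g B
  using LSPK unfolding LSPK_def left_symmetric_algebra_def by unfold_locales auto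

lemma m_bilinear: "bilinear_on g g g m"
  using LSPK unfolding LSPK_def left_symmetric_algebra_def by auto

lemma left_symmetric:
  "X \<in> g \<Longrightarrow> Y \<in> g \<Longrightarrow> Z \<in> g \<Longrightarrow> X \<star> Y \<star> Z - X \<star> (Y \<star> Z) = Y \<star> X \<star> Z - Y \<star> (X \<star> Z)"
  using LSPK unfolding LSPK_def left_symmetric_algebra_def associator_def by blast

lemma m_lin [simp]:
  assumes "X \<in> g" "Y \<in> g"
  shows "X \<star> Y \<in> g" "(c *\<^sub>R X) \<star> Y = c *\<^sub>R (X \<star> Y)" "X \<star> (c *\<^sub>R Y) = c *\<^sub>R (X \<star> Y)"
    "Z \<in> g \<Longrightarrow> (X + Y) \<star> Z = X \<star> Z + Y \<star> Z" "Z \<in> g \<Longrightarrow> Z \<star> (X + Y) = Z \<star> X + Z \<star> Y"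
    "Z \<in> g \<Longrightarrow> (X - Y) \<star> Z = X \<star> Z - Y \<star> Z" "Z \<in> g \<Longrightarrow> Z \<star> (X - Y) = Z \<star> X - Z \<star> Y"
proof -
  note l = bilinear_on_linear[OF m_bilinear]
  note linear_on_mem[OF l(1)] linear_on_add[OF l(1)] linear_on_add[OF l(2)]
    linear_on_scale[OF l(1)] linear_on_scale[OF l(2)]
    linear_on_diff[OF l(1) subspace] linear_on_diff[OF l(2) subspace]
  note rules = this
  show "X \<star> Y \<in> g" "(c *\<^sub>R X) \<star> Y = c *\<^sub>R (X \<star> Y)" "X \<star> (c *\<^sub>R Y) = c *\<^sub>R (X \<star> Y)"
    "Z \<in> g \<Longrightarrow> (X + Y) \<star> Z = X \<star> Z + Y \<star> Z" "Z \<in> g \<Longrightarrow> Z \<star> (X + Y) = Z \<star> X + Z \<star> Y"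
    "Z \<in> g \<Longrightarrow> (X - Y) \<star> Z = X \<star> Z - Y \<star> Z" "Z \<in> g \<Longrightarrow> Z \<star> (X - Y) = Z \<star> X - Z \<star> Y"
    using assms by (simp_all add: rules)
qed

lemma m_zero [simp]: "X \<in> g \<Longrightarrow> X \<star> 0 = 0" "X \<in> g \<Longrightarrow> 0 \<star> X = 0"
  using m_lin(3)[of X X 0] m_lin(2)[of X X 0] by simp_all

lemma trace_left_mult_linear: "linear_on g UNIV (\<lambda>X. trace_on g (m X))"
proof -
  obtain b where b: "orthonormal_basis b" using orthonormal_basis_exists by blast
  have "trace_on g (m X) = (\<Sum>e\<in>b. B (X \<star> e) e)" if "X \<in> g" for X
    using trace_on_orthonormal_basis[OF bilinear_on_linear(1)[OF m_bilinear that] b] .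
  then show ?thesis
    using orthonormal_basisD(3)[OF b]
    by (simp add: linear_on_def sum.distrib sum_distrib_left)
qed

text \<open>
  The vector of the linear form \<open>X \<mapsto> tr L\<^sub>X\<close>; it turns out to be the element \<open>H\<close> of the
  construction.
\<close>

definition H :: 'g where "H = riesz_on g B (\<lambda>X. trace_on g (m X))"

lemma H_mem [simp]: "H \<in> g"
  and H_left: "X \<in> g \<Longrightarrow> B H X = trace_on g (m X)"
  using riesz_on[OF fin_dim sp trace_left_mult_linear] by (auto simp: H_def)

lemma B_eq: "X \<in> g \<Longrightarrow> Y \<in> g \<Longrightarrow> B H (X \<star> Y) = B X Y"
  using H_left[of "X \<star> Y"] koszul_form_def[of g m X Y] by simp

text \<open>
  Left symmetry paired with \<open>H\<close>; in geometric terms, \<open>B\<close> is a Hessian metric.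
\<close>

lemma codazzi:
  assumes "X \<in> g" "Y \<in> g" "Z \<in> g"
  shows "B (X \<star> Y) Z - B X (Y \<star> Z) = B (Y \<star> X) Z - B Y (X \<star> Z)"
  using arg_cong[OF left_symmetric[OF assms], of "B H"] assms by (simp add: B_eq)

definition S where "S X = X \<star> H"

lemma S_lin [simp]:
  "X \<in> g \<Longrightarrow> S X \<in> g" "X \<in> g \<Longrightarrow> Y \<in> g \<Longrightarrow> S (X + Y) = S X + S Y"
  "X \<in> g \<Longrightarrow> S (c *\<^sub>R X) = c *\<^sub>R S X" "X \<in> g \<Longrightarrow> Y \<in> g \<Longrightarrow> S (X - Y) = S X - S Y" "S 0 = 0"
  by (simp_all add: S_def)

lemma S_symmetric: "X \<in> g \<Longrightarrow> Y \<in> g \<Longrightarrow> B (S X) Y = B X (S Y)"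
  using codazzi[of X Y H] B_eq[of X Y] B_eq[of Y X] ip_commute[of X Y] ip_commute[of Y "S X"]
    ip_commute[of "X \<star> Y" H] ip_commute[of "Y \<star> X" H]
  by (simp add: S_def)

text \<open>
  \<open>B(S H, Z) = B(H, Z \<star> H) = B(Z, H)\<close>, by the symmetry of \<open>S\<close> and the choice of \<open>H\<close>.
\<close>

lemma S_H [simp]: "S H = H"
proof (rule ip_eqI)
  fix Z assume "Z \<in> g"
  then show "B (S H) Z = B H Z"
    using S_symmetric[of H Z] B_eq[of Z H] ip_commute[of Z H] by (simp add: S_def)
qed auto

lemma H_adjoint:
  assumes "Y \<in> g" "Z \<in> g"
  shows "B (H \<star> Y) Z + B Y (H \<star> Z) = B Y Z + B (S Y) Z"
  using codazzi[of H Y Z] B_eq[of Y Z] assms by (simp add: S_def)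

text \<open>
  Left symmetry in \<open>H, Y, H\<close> is the commutator relation \<open>[L\<^sub>H, S] = S - S\<^sup>2\<close>, since \<open>H \<star> H = H\<close>.
\<close>

lemma S_idem [simp]:
  assumes "X \<in> g"
  shows "S (S X) = S X"
proof (rule idempotent_of_commutator[of "m H" S, OF _ _ S_symmetric _ assms])
  show "linear_on g g (m H)" "linear_on g g S" by (auto simp: linear_on_def)
  fix Y assume "Y \<in> g"
  then show "H \<star> S Y - S (H \<star> Y) = S Y - S (S Y)"
    using left_symmetric[of H Y H] S_H by (simp add: S_def algebra_simps)
qed auto

lemma S_H_commute:
  assumes "Y \<in> g"
  shows "S (H \<star> Y) = H \<star> S Y"
  using left_symmetric[of H Y H] S_idem[OF assms] S_H assms by (simp add: S_def algebra_simps)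

text \<open>
  Half of \<open>1 + S = L\<^sub>H + L\<^sub>H\<^sup>t\<close> is the symmetric part of \<open>L\<^sub>H\<close>, so this is the skew part.
\<close>

definition A where "A X = H \<star> X - (1/2) *\<^sub>R (X + S X)"

lemma A_lin [simp]:
  "X \<in> g \<Longrightarrow> A X \<in> g" "X \<in> g \<Longrightarrow> Y \<in> g \<Longrightarrow> A (X + Y) = A X + A Y"
  "X \<in> g \<Longrightarrow> A (c *\<^sub>R X) = c *\<^sub>R A X"
  by (simp_all add: A_def algebra_simps)

lemma A_skew: "X \<in> g \<Longrightarrow> Y \<in> g \<Longrightarrow> B (A X) Y = - B X (A Y)"
  using H_adjoint[of X Y] S_symmetric[of X Y] by (simp add: A_def algebra_simps)

lemma A_H: "A H = 0"
  using S_H scaleR_half_double[of H] by (simp add: A_def S_def algebra_simps)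

lemma S_A: "X \<in> g \<Longrightarrow> S (A X) = A (S X)"
  by (simp add: A_def S_H_commute)

text \<open>
  These become \<open>h1\<close> and \<open>h2\<close>: together with \<open>\<real>H\<close> they split \<open>g\<close> into the eigenspaces of the
  projection \<open>S\<close>, which fixes \<open>H\<close>.
\<close>

definition g1 where "g1 = {X \<in> g. S X = 0}"
definition g2 where "g2 = {X \<in> g. S X = X \<and> B X H = 0}"

lemma g1I: "X \<in> g \<Longrightarrow> S X = 0 \<Longrightarrow> X \<in> g1"
  and g2I: "X \<in> g \<Longrightarrow> S X = X \<Longrightarrow> B X H = 0 \<Longrightarrow> X \<in> g2"
  by (simp_all add: g1_def g2_def)

lemma g1D [simp]: "x \<in> g1 \<Longrightarrow> x \<in> g" "x \<in> g1 \<Longrightarrow> S x = 0"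
  by (auto simp: g1_def)

lemma g2D [simp]: "a \<in> g2 \<Longrightarrow> a \<in> g" "a \<in> g2 \<Longrightarrow> S a = a" "a \<in> g2 \<Longrightarrow> B a H = 0" "a \<in> g2 \<Longrightarrow> B H a = 0"
  using ip_commute[of a H] by (auto simp: g2_def)

lemma g1_orth [simp]:
  assumes "x \<in> g1"
  shows "B x H = 0" "B H x = 0" "a \<in> g2 \<Longrightarrow> B x a = 0" "a \<in> g2 \<Longrightarrow> B a x = 0"
proof -
  show 1: "B x H = 0" using S_symmetric[of x H] assms by simp
  show 2: "B x a = 0" if "a \<in> g2" for a using S_symmetric[of x a] assms that by simp
  show "B H x = 0" using 1 ip_commute[of x H] assms by simp
  show "B a x = 0" if "a \<in> g2" using 2[OF that] ip_commute[of x a] assms that by simp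
qed

lemma subspace_g1: "subspace g1" and subspace_g2: "subspace g2"
  by (auto simp: subspace_def intro!: g1I g2I)

definition r where "r = B H H"

lemma r_pos: "0 < r"
proof -
  have "H \<noteq> 0"
  proof
    assume 0: "H = 0"
    have "X = 0" if "X \<in> g" for X
      using B_eq[OF that that] ip_eq_0_iff[OF that] that unfolding 0 by simp
    moreover have "g \<noteq> {0}" using LSPK by (simp add: LSPK_def)
    ultimately show False using mem(1) by blast
  qed
  then show ?thesis unfolding r_def by (rule ip_pos[OF H_mem])
qed

definition H_coeff where "H_coeff X = B X H / r"
definition P1 where "P1 X = X - S X"
definition P2 where "P2 X = S X - H_coeff X *\<^sub>R H"

lemma P1_mem [simp]: "X \<in> g \<Longrightarrow> P1 X \<in> g1"
  by (rule g1I) (simp_all add: P1_def)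

lemma P2_mem [simp]: "X \<in> g \<Longrightarrow> P2 X \<in> g2"
  using r_pos S_symmetric[of X H] by (intro g2I) (simp_all add: P2_def H_coeff_def r_def)

lemma decomp: "X \<in> g \<Longrightarrow> P1 X + P2 X + H_coeff X *\<^sub>R H = X"
  by (simp add: P1_def P2_def)

lemma P_lin [simp]:
  "X \<in> g \<Longrightarrow> Y \<in> g \<Longrightarrow> P1 (X + Y) = P1 X + P1 Y" "X \<in> g \<Longrightarrow> P1 (c *\<^sub>R X) = c *\<^sub>R P1 X"
  "X \<in> g \<Longrightarrow> Y \<in> g \<Longrightarrow> P2 (X + Y) = P2 X + P2 Y" "X \<in> g \<Longrightarrow> P2 (c *\<^sub>R X) = c *\<^sub>R P2 X"
  "X \<in> g \<Longrightarrow> Y \<in> g \<Longrightarrow> H_coeff (X + Y) = H_coeff X + H_coeff Y" "X \<in> g \<Longrightarrow> H_coeff (c *\<^sub>R X) = c * H_coeff X"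
  by (simp_all add: P1_def P2_def H_coeff_def algebra_simps add_divide_distrib)

lemma P_cases [simp]:
  "x \<in> g1 \<Longrightarrow> P1 x = x" "x \<in> g1 \<Longrightarrow> P2 x = 0" "x \<in> g1 \<Longrightarrow> H_coeff x = 0"
  "a \<in> g2 \<Longrightarrow> P1 a = 0" "a \<in> g2 \<Longrightarrow> P2 a = a" "a \<in> g2 \<Longrightarrow> H_coeff a = 0"
  "P1 H = 0" "P2 H = 0" "H_coeff H = 1"
  using r_pos by (simp_all add: P1_def P2_def H_coeff_def r_def)

lemma B_P1: "Z \<in> g \<Longrightarrow> x \<in> g1 \<Longrightarrow> B (P1 Z) x = B Z x"
  using S_symmetric[of Z x] by (simp add: P1_def)

lemma B_P2: "Z \<in> g \<Longrightarrow> a \<in> g2 \<Longrightarrow> B (P2 Z) a = B Z a"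
  using S_symmetric[of Z a] by (simp add: P2_def)

lemma H_coeff_m: "X \<in> g \<Longrightarrow> Y \<in> g \<Longrightarrow> H_coeff (X \<star> Y) = B X Y / r"
  using B_eq[of X Y] ip_commute[of H "X \<star> Y"] by (simp add: H_coeff_def)

lemma A_g1: "x \<in> g1 \<Longrightarrow> A x \<in> g1"
  by (rule g1I) (simp_all add: S_A, simp add: A_def)

lemma A_g2: "a \<in> g2 \<Longrightarrow> A a \<in> g2"
  using A_skew[of a H] by (intro g2I) (simp_all add: S_A A_H)

lemma H_g1: "x \<in> g1 \<Longrightarrow> H \<star> x = A x + (1/2) *\<^sub>R x"
  by (simp add: A_def)

lemma H_g2: "a \<in> g2 \<Longrightarrow> H \<star> a = A a + a"
  using scaleR_half_double[of a] by (simp add: A_def)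

lemma S_commutator:
  assumes "X \<in> g" "Y \<in> g"
  shows "S (X \<star> Y) - X \<star> S Y = S (Y \<star> X) - Y \<star> S X"
  using left_symmetric[of X Y H] assms by (simp add: S_def)

text \<open>
  For \<open>x\<close> in \<open>g1\<close> and \<open>a\<close> in \<open>g2\<close> the commutator rule reads \<open>S (x \<star> a) - x \<star> a = S (a \<star> x)\<close>.  The left
  side lies in the kernel of the projection \<open>S\<close> and the right side in its image, so both vanish.
\<close>

lemma g2_g1: "a \<in> g2 \<Longrightarrow> x \<in> g1 \<Longrightarrow> a \<star> x \<in> g1"
  and g1_g2: "x \<in> g1 \<Longrightarrow> a \<in> g2 \<Longrightarrow> x \<star> a \<in> g2"
proof -
  assume ax: "a \<in> g2" "x \<in> g1"
  have e: "S (x \<star> a) - x \<star> a = S (a \<star> x)" using S_commutator[of x a] ax by simp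
  have 0: "S (a \<star> x) = 0" using arg_cong[OF e, of S] ax by simp
  then show "a \<star> x \<in> g1" using ax by (intro g1I) simp_all
  show "x \<star> a \<in> g2"
    using ax e 0 B_eq[of x a] ip_commute[of H "x \<star> a"] by (intro g2I) simp_all
qed

text \<open>
  \<open>L\<^sub>H\<close> is almost a derivation: for \<open>x\<close> in \<open>g1\<close>, where \<open>x \<star> H = 0\<close>, left symmetry gives
  \<open>H \<star> (x \<star> y) = (H \<star> x) \<star> y + x \<star> (H \<star> y)\<close>.  Now take \<open>g1\<close>-parts, where
  \<open>L\<^sub>H = A + 1/2\<close>: the two halves on the right exceed the one on the left by 1/2, which would be
  an eigenvalue of a skew action.
\<close>

lemma P1_g1_g1:
  assumes "x \<in> g1" "y \<in> g1"
  shows "P1 (x \<star> y) = 0"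
proof -
  interpret E: euclidean_on g1 B
    by (rule euclidean_on_subspace[OF euclidean_on_axioms subspace_g1]) auto
  show ?thesis
  proof (rule E.skew_eigen_bilinear_zero[where A = A and c = "1/2" and a = "\<lambda>x y. P1 (x \<star> y)"])
    show "linear_on g1 g1 A" using A_g1 by (simp add: linear_on_def)
    show "bilinear_on g1 g1 g1 (\<lambda>x y. P1 (x \<star> y))" by (rule bilinear_onI) auto
    fix x y assume xy: "x \<in> g1" "y \<in> g1"
    show "B (A x) y = - B x (A y)" using A_skew xy by simp
    let ?z = "x \<star> y"
    have xH: "x \<star> H = 0" using xy g1D(2)[of x] by (simp add: S_def)
    have "H \<star> ?z = (H \<star> x) \<star> y + x \<star> (H \<star> y)"
      using left_symmetric[of H x y] xy xH by (simp add: algebra_simps)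
    also have "\<dots> = A x \<star> y + x \<star> A y + ?z"
      using xy A_g1 scaleR_half_double[of ?z] by (simp add: H_g1 algebra_simps)
    finally have e: "H \<star> ?z = A x \<star> y + x \<star> A y + ?z" .
    have "A (P1 ?z) + (1/2) *\<^sub>R P1 ?z = H \<star> P1 ?z" using xy by (simp add: H_g1)
    also have "\<dots> = P1 (H \<star> ?z)" using xy by (simp add: P1_def S_H_commute)
    also have "\<dots> = P1 (A x \<star> y) + P1 (x \<star> A y) + P1 ?z" unfolding e using xy A_g1 by simp
    also have "\<dots> = (P1 (A x \<star> y) + P1 (x \<star> A y) + (1/2) *\<^sub>R P1 ?z) + (1/2) *\<^sub>R P1 ?z"
      using scaleR_half_double[of "P1 ?z"] by (simp add: scaleR_right_distrib add.assoc)
    finally show "A (P1 ?z) = P1 (A x \<star> y) + P1 (x \<star> A y) + (1/2) *\<^sub>R P1 ?z"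
      by (rule add_right_imp_eq)
  qed (use assms in auto)
qed

text \<open>
  The Koszul form is rescaled such that \<open>H\<close> becomes a unit vector, as in the triple model.
\<close>

definition ip where "ip X Y = B X Y / r"

sublocale N: euclidean_on g ip
proof
  show "scalar_product_on g ip"
    unfolding scalar_product_on_def ip_def
    using r_pos ip_pos ip_commute
    by (auto intro!: bilinear_onI simp: add_divide_distrib)
qed (rule fin_dim)

abbreviation m2 where "m2 a b \<equiv> P2 (a \<star> b)"

sublocale D: lspk_predata g1 ip g2 m2 ip A A m m
proof
  have "euclidean_on g1 ip" "euclidean_on g2 ip"
    by (rule euclidean_on_subspace[OF N.euclidean_on_axioms]; simp add: subspace_g1 subspace_g2 subset_iff)+
  then show "fin_dim_subspace g1" "scalar_product_on g1 ip" "fin_dim_subspace g2" "scalar_product_on g2 ip"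
    by (simp_all add: euclidean_on_def)
  show "bilinear_on g2 g2 g2 m2" by (rule bilinear_onI) auto
  show "linear_on g1 g1 A" "linear_on g2 g2 A" using A_g1 A_g2 by (simp_all add: linear_on_def)
  show "bilinear_on g1 g2 g2 m" "bilinear_on g2 g1 g1 m"
    by (rule bilinear_onI; simp add: g1_g2 g2_g1)+
qed (use A_skew in \<open>auto simp: ip_def\<close>)

text \<open>
  The Codazzi equation for \<open>x, a, y\<close> loses the term \<open>B(x \<star> a, y)\<close>, because \<open>x \<star> a\<close> lies in \<open>g2\<close>, and
  becomes the equation that defines \<open>\<omega>1\<close>.
\<close>

lemma omega1_eq:
  assumes "x \<in> g1" "y \<in> g1"
  shows "D.\<omega>1 x y = P2 (x \<star> y)"
proof (rule D.E2.ip_eqI)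
  fix a assume a: "a \<in> g2"
  have "B (P2 (x \<star> y)) a = B a (x \<star> y)" using a assms B_P2 ip_commute[of a "x \<star> y"] by simp
  also have "\<dots> = B (a \<star> x) y + B x (a \<star> y)"
    using codazzi[of x a y] a assms g1_g2[of x a] by simp
  finally show "ip (D.\<omega>1 x y) a = ip (P2 (x \<star> y)) a"
    using a assms ip_commute[of x "a \<star> y"]
    unfolding D.\<omega>1_ip[OF assms a] by (simp add: ip_def add_divide_distrib)
qed (use assms in \<open>auto simp: D.\<omega>1_mem\<close>)

text \<open>
  Likewise, with \<open>B(a \<star> x, b) = 0\<close> because \<open>a \<star> x\<close> lies in \<open>g1\<close>.
\<close>

lemma omega2_eq:
  assumes "a \<in> g2" "b \<in> g2"
  shows "D.\<omega>2 a b = P1 (a \<star> b)"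
proof (rule D.E1.ip_eqI)
  fix x assume x: "x \<in> g1"
  have "B (P1 (a \<star> b)) x = B x (a \<star> b)" using x assms B_P1 ip_commute[of x "a \<star> b"] by simp
  also have "\<dots> = B (x \<star> a) b + B a (x \<star> b)"
    using codazzi[of a x b] x assms g2_g1[of a x] by simp
  finally show "ip (D.\<omega>2 a b) x = ip (P1 (a \<star> b)) x"
    using x assms ip_commute[of a "x \<star> b"]
    unfolding D.\<omega>2_ip[OF assms x] by (simp add: ip_def add_divide_distrib)
qed (use assms in \<open>auto simp: D.\<omega>2_mem\<close>)

definition \<psi> :: "'g \<times> 'g \<times> real \<Rightarrow> 'g" where "\<psi> = (\<lambda>(x, a, s). x + a + s *\<^sub>R H)"
definition \<phi> :: "'g \<Rightarrow> 'g \<times> 'g \<times> real" where "\<phi> X = (P1 X, P2 X, H_coeff X)"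

lemma \<psi>_diff: "\<psi> (u - v) = \<psi> u - \<psi> v"
  by (cases u; cases v) (simp add: \<psi>_def algebra_simps)

lemma \<psi>_linear: "linear_on D.G g \<psi>"
  by (auto simp: linear_on_def \<psi>_def lspk_carrier_def algebra_simps)

lemma \<phi>_linear: "linear_on g D.G \<phi>"
  by (auto simp: linear_on_def \<phi>_def lspk_carrier_def)

lemma \<psi>_\<phi>: "X \<in> g \<Longrightarrow> \<psi> (\<phi> X) = X"
  by (simp add: \<psi>_def \<phi>_def decomp)

lemma \<phi>_\<psi>: "u \<in> D.G \<Longrightarrow> \<phi> (\<psi> u) = u"
  by (auto simp: \<psi>_def \<phi>_def lspk_carrier_def)

lemma \<psi>_mult:
  assumes "u \<in> D.G" "v \<in> D.G"
  shows "\<psi> (D.lspk_mult u v) = \<psi> u \<star> \<psi> v"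
proof -
  obtain x a s y b t where u: "u = (x, a, s)" "x \<in> g1" "a \<in> g2"
    and v: "v = (y, b, t)" "y \<in> g1" "b \<in> g2"
    using assms unfolding lspk_carrier_def by auto
  have xy: "x \<star> y = P2 (x \<star> y) + ip x y *\<^sub>R H"
    using decomp[of "x \<star> y"] P1_g1_g1[of x y] u v by (simp add: H_coeff_m ip_def)
  have ab: "a \<star> b = P1 (a \<star> b) + P2 (a \<star> b) + ip a b *\<^sub>R H"
    using decomp[of "a \<star> b"] u v by (simp add: H_coeff_m ip_def)
  have H: "x \<star> H = 0" "a \<star> H = a" "H \<star> H = H"
    using g1D(2)[OF u(2)] g2D(2)[OF u(3)] S_H by (simp_all add: S_def)
  have "\<psi> u \<star> \<psi> v = x \<star> y + x \<star> b + a \<star> y + a \<star> b + t *\<^sub>R a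
      + s *\<^sub>R (H \<star> y) + s *\<^sub>R (H \<star> b) + (s * t) *\<^sub>R H"
    using u v by (simp add: \<psi>_def H algebra_simps)
  also have "\<dots> = (P2 (x \<star> y) + ip x y *\<^sub>R H) + x \<star> b + a \<star> y
      + (P1 (a \<star> b) + P2 (a \<star> b) + ip a b *\<^sub>R H) + t *\<^sub>R a
      + s *\<^sub>R (A y + (1/2) *\<^sub>R y) + s *\<^sub>R (A b + b) + (s * t) *\<^sub>R H"
    using xy ab H_g1[OF v(2)] H_g2[OF v(3)] by simp
  also have "\<dots> = \<psi> (D.lspk_mult u v)"
    using u v by (simp add: \<psi>_def lspk_prod_def omega1_eq omega2_eq scaleR_add_left)
  finally show ?thesis by simp
qed

lemma \<psi>_isometry:
  assumes "u \<in> D.G" "v \<in> D.G"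
  shows "ip (\<psi> u) (\<psi> v) = D.ipG u v"
proof -
  obtain x a s y b t where "u = (x, a, s)" "x \<in> g1" "a \<in> g2" "v = (y, b, t)" "y \<in> g1" "b \<in> g2"
    using assms unfolding lspk_carrier_def by auto
  then show ?thesis
    using r_pos by (simp add: \<psi>_def D.ipG_def ip_def r_def[symmetric] field_simps)
qed

text \<open>
  The trace is transported to \<open>g\<close>, where it is \<open>B(H, \<psi> (x, a, s)) = s B(H, H)\<close>.
\<close>

lemma trace_D:
  assumes "x \<in> g1" "a \<in> g2"
  shows "trace_on D.G (D.lspk_mult (x, a, s)) = s * r"
proof -
  have u: "(x, a, s) \<in> D.G" using assms by (simp add: lspk_carrier_def)
  have pg: "\<psi> (x, a, s) \<in> g" using linear_on_mem[OF \<psi>_linear u] .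
  have "\<psi> ` D.G = g"
    using linear_on_mem[OF \<psi>_linear] linear_on_mem[OF \<phi>_linear] \<psi>_\<phi>
    by (metis image_subset_iff subsetI subset_antisym image_eqI)
  then have "trace_on D.G (D.lspk_mult (x, a, s)) = trace_on g (m (\<psi> (x, a, s)))"
    by (intro trace_on_isometry[OF D.EG.euclidean_on_axioms N.euclidean_on_axioms \<psi>_linear]
        \<psi>_isometry bilinear_on_linear(1)[OF D.lspk_mult_bilinear u]
        bilinear_on_linear(1)[OF m_bilinear pg] \<psi>_mult u)
  also have "\<dots> = B H (\<psi> (x, a, s))" using pg by (simp add: H_left)
  also have "\<dots> = s * r" using assms by (simp add: \<psi>_def r_def)
  finally show ?thesis .
qed

text \<open>
  Left symmetry is transported along the isomorphism.  Since \<open>tr L\<^sub>H\<close> is \<open>r\<close> on the one hand and has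
  been computed from the dimensions on the other, \<open>trace_D\<close> is the required trace formula.
\<close>

theorem lspk_data_of_LSPK: "lspk_data g1 ip g2 m2 ip A A m m"
  unfolding D.lspk_data_iff
proof (intro conjI ballI allI)
  fix X Y Z assume XYZ: "X \<in> D.G" "Y \<in> D.G" "Z \<in> D.G"
  note lm = linear_on_mem[OF bilinear_on_linear(1)[OF D.lspk_mult_bilinear]]
  note pm = linear_on_mem[OF \<psi>_linear]
  have "\<psi> (lsym_defect D.lspk_mult X Y Z) = lsym_defect m (\<psi> X) (\<psi> Y) (\<psi> Z)"
    using XYZ by (simp add: lsym_defect_def associator_def \<psi>_diff \<psi>_mult lm)
  also have "\<dots> = 0" using left_symmetric[OF pm pm pm, OF XYZ] by (simp add: lsym_defect_def associator_def)
  finally have "\<psi> (lsym_defect D.lspk_mult X Y Z) = 0" .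
  moreover have "lsym_defect D.lspk_mult X Y Z \<in> D.G"
    using linear_on_mem[OF D.lsym_defect_linear(1)[OF XYZ(1,2)] XYZ(3)] .
  ultimately show "lsym_defect D.lspk_mult X Y Z = 0"
    using \<phi>_\<psi> linear_on_0[OF \<phi>_linear subspace] by metis
next
  have "r = trace_on D.G (D.lspk_mult (0, 0, 1))" using trace_D[of 0 0 1] D.zero_laws(1,2) by simp
  also have "\<dots> = 1/2 * real (dim g1) + real (dim g2) + 1" by (rule D.trace_lspk_mult_H)
  finally have r: "r = 1/2 * real (dim g1) + real (dim g2) + 1" .
  fix x a s assume "x \<in> g1" "a \<in> g2"
  then show "trace_on D.G (D.lspk_mult (x, a, s)) = s * (1/2 * real (dim g1) + real (dim g2) + 1)"
    using trace_D r by simp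
qed

theorem isomorphic_lspk_mult: "algebra_isomorphic g m D.G D.lspk_mult"
  unfolding algebra_isomorphic_def
proof (intro exI[of _ \<phi>] conjI ballI)
  show "linear_on g D.G \<phi>" by (rule \<phi>_linear)
  show "bij_betw \<phi> g D.G"
    using linear_on_mem[OF \<psi>_linear] linear_on_mem[OF \<phi>_linear] \<psi>_\<phi> \<phi>_\<psi>
    by (intro bij_betw_byWitness[of _ \<psi>]) auto
  fix X Y assume XY: "X \<in> g" "Y \<in> g"
  note pm = linear_on_mem[OF \<phi>_linear]
  have "X \<star> Y = \<psi> (D.lspk_mult (\<phi> X) (\<phi> Y))" using XY pm by (simp add: \<psi>_mult \<psi>_\<phi>)
  moreover have "D.lspk_mult (\<phi> X) (\<phi> Y) \<in> D.G"
    using linear_on_mem[OF bilinear_on_linear(1)[OF D.lspk_mult_bilinear pm] pm] XY by blast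
  ultimately show "\<phi> (X \<star> Y) = D.lspk_mult (\<phi> X) (\<phi> Y)" by (simp add: \<phi>_\<psi>)
qed

end

theorem theorem3p2:
  shows
    "(\<forall>(h1 :: 'a::real_vector set) ip1 (h2 :: 'b::real_vector set) m2 ip2 B1 B2 \<rho>1 \<rho>2.
        lspk_data h1 ip1 h2 m2 ip2 B1 B2 \<rho>1 \<rho>2 \<longrightarrow>
        (let g = lspk_carrier h1 h2;
             m = lspk_prod h1 ip1 h2 m2 ip2 B1 B2 \<rho>1 \<rho>2;
             B = koszul_form g m;
             \<rho> = 1/2 * real (dim h1) + real (dim h2) + 1
         in LSPK g m \<and>
            (\<forall>X\<in>h1. \<forall>Y\<in>h2. B (X, 0, 0) (0, Y, 0) = 0) \<and>
            (\<forall>X\<in>h1. B (0, 0, 1) (X, 0, 0) = 0) \<and>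
            (\<forall>X\<in>h2. B (0, 0, 1) (0, X, 0) = 0) \<and>
            (\<forall>X\<in>h1. \<forall>Y\<in>h1. B (X, 0, 0) (Y, 0, 0) = \<rho> * ip1 X Y) \<and>
            (\<forall>X\<in>h2. \<forall>Y\<in>h2. B (0, X, 0) (0, Y, 0) = \<rho> * ip2 X Y) \<and>
            B (0, 0, 1) (0, 0, 1) = \<rho>)) \<and>
     (\<forall>(g :: 'g::real_vector set) m. LSPK g m \<longrightarrow>
        (\<exists>(h1 :: 'g set) ip1 (h2 :: 'g set) m2 ip2 B1 B2 \<rho>1 \<rho>2.
           lspk_data h1 ip1 h2 m2 ip2 B1 B2 \<rho>1 \<rho>2 \<and>
           algebra_isomorphic g m
             (lspk_carrier h1 h2) (lspk_prod h1 ip1 h2 m2 ip2 B1 B2 \<rho>1 \<rho>2)))"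
proof (intro conjI allI impI)
  fix h1 :: "'a set" and ip1 and h2 :: "'b set" and m2 ip2 B1 B2 \<rho>1 \<rho>2
  assume "lspk_data h1 ip1 h2 m2 ip2 B1 B2 \<rho>1 \<rho>2"
  then interpret lspk_data h1 ip1 h2 m2 ip2 B1 B2 \<rho>1 \<rho>2 .
  have G: "(x, a, s) \<in> G" if "x \<in> h1" "a \<in> h2" for x a s
    using that by (simp add: lspk_carrier_def)
  show "let g = lspk_carrier h1 h2;
             m = lspk_prod h1 ip1 h2 m2 ip2 B1 B2 \<rho>1 \<rho>2;
             B = koszul_form g m;
             \<rho> = 1/2 * real (dim h1) + real (dim h2) + 1
         in LSPK g m \<and>
            (\<forall>X\<in>h1. \<forall>Y\<in>h2. B (X, 0, 0) (0, Y, 0) = 0) \<and>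
            (\<forall>X\<in>h1. B (0, 0, 1) (X, 0, 0) = 0) \<and>
            (\<forall>X\<in>h2. B (0, 0, 1) (0, X, 0) = 0) \<and>
            (\<forall>X\<in>h1. \<forall>Y\<in>h1. B (X, 0, 0) (Y, 0, 0) = \<rho> * ip1 X Y) \<and>
            (\<forall>X\<in>h2. \<forall>Y\<in>h2. B (0, X, 0) (0, Y, 0) = \<rho> * ip2 X Y) \<and>
            B (0, 0, 1) (0, 0, 1) = \<rho>"
    unfolding Let_def
    using LSPK_lspk_mult by (simp add: koszul_form_lspk_mult G zero_laws ipG_def)
next
  fix g :: "'g set" and m
  assume "LSPK g m"
  then interpret lspk g m by unfold_locales
  show "\<exists>(h1 :: 'g set) ip1 (h2 :: 'g set) m2 ip2 B1 B2 \<rho>1 \<rho>2.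
           lspk_data h1 ip1 h2 m2 ip2 B1 B2 \<rho>1 \<rho>2 \<and>
           algebra_isomorphic g m
             (lspk_carrier h1 h2) (lspk_prod h1 ip1 h2 m2 ip2 B1 B2 \<rho>1 \<rho>2)"
    using lspk_data_of_LSPK isomorphic_lspk_mult by blast
qed

end
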